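(* Let $X$ be a complex manifold and let $E\to X$ be a holomorphic vector bundle with two smooth Hermitian forms $b_1$ and $b_2$ (each possibly degenerate), with Chern connections $D_{b_1}$ and $D_{b_2}$. Assume that $h := b_1+b_2$ is positive-definite. Then the curvature tensor of $h$ is $$R_h(\alpha,\overline\beta,s,\overline t) = R_{b_1}(\alpha,\overline\beta,s,\overline t) + R_{b_2}(\alpha,\overline\beta,s,\overline t) - q\bigl(\sigma(\alpha)s,\overline{\sigma(\beta)t}\bigr)$$ for all $(1,0)$ tangent fields $\alpha,\beta$ and sections $s,t$ of $E$, where $$\sigma(\alpha)s = (D_{b_1,\alpha}-D_{b_2,\alpha})s$$ and $q$ is the Hermitian form on $E$ given by $$q(s,\overline t) = b_1\bigl(h^{-1}b_2 s,\overline{h^{-1}b_2 t}\bigr) + b_2\bigl(h^{-1}b_1 s,\overline{h^{-1}b_1 t}\bigr).$$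
   Context: $b(s,\overline t)$ is linear in $s$ and conjugate linear in $t$. A Hermitian form $b$ on $E$ is viewed as a linear morphism $b:E\to\overline E^*$, so $h^{-1}b_i$ is the endomorphism of $E$ determined by $h(h^{-1}b_i s,\overline t)=b_i(s,\overline t)$ for all $t$. A Chern connection of a smooth Hermitian form $b$ is a connection $D$ on $E$ with $d\,b(s,\overline t)=b(Ds,\overline t)+b(s,\overline{Dt})$ for all smooth sections $s,t$ and with $(0,1)$-part equal to $\bar\partial$; it need not be unique if $b$ is degenerate. The curvature tensor $R_b$ of $b$ is the tensor associated with $b(\tfrac i2D^2s,\overline t)$ under the identification of a $(1,1)$-form $\tfrac i2\sum a_{jk}\,dz_j\wedge d\overline z_k$ with the sesquilinear form $(\alpha,\overline\beta)\mapsto\sum a_{jk}\alpha_j\overline\beta_k$; that is, $R_b(\alpha,\overline\beta,s,\overline t)=b(D^2(\alpha,\overline\beta)s,\overline t)$ with the normalization $(dz_j\wedge d\overline z_k)(\alpha,\overline\beta)=\alpha_j\overline\beta_k$. It does not depend on the choice of Chern connection $D$ of $b$. *)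

theory Defs
  imports "HOL-Analysis.Analysis"
begin

section \<open>Smooth and holomorphic maps of several variables\<close>

text \<open>Over an open set of a finite-dimensional space the following recursion is the usual
  class \<open>C\<^sup>k\<close>: differentiability together with \<open>C\<^sup>k\<close> directional derivatives.\<close>

primrec Ck_on :: "nat \<Rightarrow> 'a::real_normed_vector set \<Rightarrow> ('a \<Rightarrow> 'b::real_normed_vector) \<Rightarrow> bool" where
  "Ck_on 0 S f \<longleftrightarrow> continuous_on S f"
| "Ck_on (Suc k) S f \<longleftrightarrow>
     (\<forall>x\<in>S. f differentiable (at x)) \<and> (\<forall>v. Ck_on k S (\<lambda>x. frechet_derivative f (at x) v))"

definition Cinf_on :: "'a::real_normed_vector set \<Rightarrow> ('a \<Rightarrow> 'b::real_normed_vector) \<Rightarrow> bool" where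
  "Cinf_on S f \<longleftrightarrow> (\<forall>k. Ck_on k S f)"

definition holo_map_on :: "(complex^'n::finite) set \<Rightarrow> (complex^'n \<Rightarrow> complex^'m::finite) \<Rightarrow> bool" where
  "holo_map_on S f \<longleftrightarrow>
     (\<forall>z\<in>S. \<exists>L. (f has_derivative L) (at z) \<and> (\<forall>c v. L (c *s v) = c *s L v))"

text \<open>Wirtinger derivatives \<open>\<partial>/\<partial>z\<^sub>j\<close> and \<open>\<partial>/\<partial>\<close>conj\<open>(z\<^sub>j)\<close>.\<close>

definition wirtinger :: "'n::finite \<Rightarrow> (complex^'n \<Rightarrow> complex) \<Rightarrow> complex^'n \<Rightarrow> complex" where
  "wirtinger j f z =
     (frechet_derivative f (at z) (axis j 1) - \<i> * frechet_derivative f (at z) (axis j \<i>)) / 2"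

definition wirtinger_bar :: "'n::finite \<Rightarrow> (complex^'n \<Rightarrow> complex) \<Rightarrow> complex^'n \<Rightarrow> complex" where
  "wirtinger_bar j f z =
     (frechet_derivative f (at z) (axis j 1) + \<i> * frechet_derivative f (at z) (axis j \<i>)) / 2"

section \<open>Complex manifolds\<close>

text \<open>The manifold is the whole type \<open>'x\<close>, which in the theorem is Hausdorff and second
  countable; its complex structure is given by a holomorphic atlas, not necessarily maximal.
  A chart is a pair of a domain and a coordinate map, whose values outside the domain are
  irrelevant.\<close>

type_synonym ('x, 'n) chart = "'x set \<times> ('x \<Rightarrow> complex^'n)"

definition complex_manifold :: "('x::topological_space, 'n::finite) chart set \<Rightarrow> bool" where
  "complex_manifold A \<longleftrightarrow>
     (\<forall>(U, \<phi>)\<in>A. open U \<and> open (\<phi> ` U) \<and> homeomorphism U (\<phi> ` U) \<phi> (inv_into U \<phi>)) \<and>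
     (\<Union>(U, \<phi>)\<in>A. U) = UNIV \<and>
     (\<forall>(U, \<phi>)\<in>A. \<forall>(V, \<tau>)\<in>A. holo_map_on (\<phi> ` (U \<inter> V)) (\<tau> \<circ> inv_into U \<phi>))"

definition smooth_on ::
  "('x, 'n::finite) chart set \<Rightarrow> 'x set \<Rightarrow> ('x \<Rightarrow> 'b::real_normed_vector) \<Rightarrow> bool" where
  "smooth_on A W f \<longleftrightarrow> (\<forall>(U, \<phi>)\<in>A. Cinf_on (\<phi> ` (U \<inter> W)) (f \<circ> inv_into U \<phi>))"

definition holomorphic_map_on ::
  "('x, 'n::finite) chart set \<Rightarrow> 'x set \<Rightarrow> ('x \<Rightarrow> complex^'m::finite) \<Rightarrow> bool" where
  "holomorphic_map_on A W f \<longleftrightarrow> (\<forall>(U, \<phi>)\<in>A. holo_map_on (\<phi> ` (U \<inter> W)) (f \<circ> inv_into U \<phi>))"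

definition smooth_near ::
  "('x::topological_space, 'n::finite) chart set \<Rightarrow> 'x \<Rightarrow> ('x \<Rightarrow> 'b::real_normed_vector) \<Rightarrow> bool" where
  "smooth_near A x f \<longleftrightarrow> (\<exists>W. open W \<and> x \<in> W \<and> smooth_on A W f)"

section \<open>Complexified tangent vectors\<close>

text \<open>A complex tangent vector at \<open>x\<close> is encoded by its action on complex-valued functions
  that are smooth near \<open>x\<close>. It is set to \<open>0\<close> on all other functions, so that a vector
  is determined by its action on germs and does not depend on the chart used to write it.\<close>

type_synonym 'x ctangent = "('x \<Rightarrow> complex) \<Rightarrow> complex"

definition coord_dz :: "('x::topological_space, 'n::finite) chart set \<Rightarrow> ('x, 'n) chart \<Rightarrow>
    'n \<Rightarrow> 'x \<Rightarrow> 'x ctangent" where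
  "coord_dz A c j x f =
     (if smooth_near A x f then wirtinger j (f \<circ> inv_into (fst c) (snd c)) (snd c x) else 0)"

definition coord_dzbar :: "('x::topological_space, 'n::finite) chart set \<Rightarrow> ('x, 'n) chart \<Rightarrow>
    'n \<Rightarrow> 'x \<Rightarrow> 'x ctangent" where
  "coord_dzbar A c j x f =
     (if smooth_near A x f then wirtinger_bar j (f \<circ> inv_into (fst c) (snd c)) (snd c x) else 0)"

definition T10 :: "('x::topological_space, 'n::finite) chart set \<Rightarrow> 'x \<Rightarrow> 'x ctangent set" where
  "T10 A x = {v. \<exists>c\<in>A. x \<in> fst c \<and> (\<exists>a. v = (\<lambda>f. \<Sum>j\<in>UNIV. a j * coord_dz A c j x f))}"

definition T01 :: "('x::topological_space, 'n::finite) chart set \<Rightarrow> 'x \<Rightarrow> 'x ctangent set" where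
  "T01 A x = {v. \<exists>c\<in>A. x \<in> fst c \<and> (\<exists>a. v = (\<lambda>f. \<Sum>j\<in>UNIV. a j * coord_dzbar A c j x f))}"

definition TC :: "('x::topological_space, 'n::finite) chart set \<Rightarrow> 'x \<Rightarrow> 'x ctangent set" where
  "TC A x = {v. \<exists>u\<in>T10 A x. \<exists>w\<in>T01 A x. v = (\<lambda>f. u f + w f)}"

definition conj_vec :: "'x ctangent \<Rightarrow> 'x ctangent" where
  "conj_vec v f = cnj (v (\<lambda>y. cnj (f y)))"

definition smooth_field ::
  "('x::topological_space, 'n::finite) chart set \<Rightarrow> 'x set \<Rightarrow> ('x \<Rightarrow> 'x ctangent) \<Rightarrow> bool" where
  "smooth_field A U \<xi> \<longleftrightarrow>
     (\<forall>x\<in>U. \<xi> x \<in> TC A x) \<and>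
     (\<forall>W f. open W \<longrightarrow> W \<subseteq> U \<longrightarrow> smooth_on A W f \<longrightarrow> smooth_on A W (\<lambda>x. \<xi> x f))"

definition smooth_field10 ::
  "('x::topological_space, 'n::finite) chart set \<Rightarrow> 'x set \<Rightarrow> ('x \<Rightarrow> 'x ctangent) \<Rightarrow> bool" where
  "smooth_field10 A U \<xi> \<longleftrightarrow> smooth_field A U \<xi> \<and> (\<forall>x\<in>U. \<xi> x \<in> T10 A x)"

definition lie_bracket :: "('x::topological_space, 'n::finite) chart set \<Rightarrow>
    ('x \<Rightarrow> 'x ctangent) \<Rightarrow> ('x \<Rightarrow> 'x ctangent) \<Rightarrow> 'x \<Rightarrow> 'x ctangent" where
  "lie_bracket A \<xi> \<eta> x f =
     (if smooth_near A x f then \<xi> x (\<lambda>y. \<eta> y f) - \<eta> x (\<lambda>y. \<xi> y f) else 0)"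

section \<open>Holomorphic vector bundles\<close>

text \<open>The fibres are complex vector spaces, realised as subspaces of one complex vector space
  \<open>'v\<close> with scalar multiplication \<open>vscale\<close>. This is no restriction, since one may take
  the direct sum of all fibres; \<open>'v\<close> carries no topology, and fibres over different points
  are unrelated. A trivialisation is a pair of a domain \<open>U\<close> and a family of linear
  isomorphisms from the fibres over \<open>U\<close> to the model fibre.\<close>

record ('x, 'v, 'r) vbundle =
  fibre :: "'x \<Rightarrow> 'v set"
  vscale :: "complex \<Rightarrow> 'v \<Rightarrow> 'v"
  trivs :: "('x set \<times> ('x \<Rightarrow> 'v \<Rightarrow> complex^'r)) set"

definition holomorphic_vector_bundle :: "('x::topological_space, 'n::finite) chart set \<Rightarrow>
    ('x, 'v::ab_group_add, 'r::finite) vbundle \<Rightarrow> bool" where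
  "holomorphic_vector_bundle A E \<longleftrightarrow>
     vector_space (vscale E) \<and>
     (\<forall>x. module.subspace (vscale E) (fibre E x)) \<and>
     (\<Union>(U, \<psi>)\<in>trivs E. U) = UNIV \<and>
     (\<forall>(U, \<psi>)\<in>trivs E. open U \<and>
        (\<forall>x\<in>U. bij_betw (\<psi> x) (fibre E x) UNIV \<and>
           (\<forall>u\<in>fibre E x. \<forall>w\<in>fibre E x. \<psi> x (u + w) = \<psi> x u + \<psi> x w) \<and>
           (\<forall>c. \<forall>u\<in>fibre E x. \<psi> x (vscale E c u) = c *s \<psi> x u))) \<and>
     (\<forall>(U, \<psi>)\<in>trivs E. \<forall>(V, \<tau>)\<in>trivs E. \<forall>e.
        holomorphic_map_on A (U \<inter> V) (\<lambda>x. \<tau> x (inv_into (fibre E x) (\<psi> x) e)))"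

definition smooth_section :: "('x::topological_space, 'n::finite) chart set \<Rightarrow>
    ('x, 'v::ab_group_add, 'r::finite) vbundle \<Rightarrow> 'x set \<Rightarrow> ('x \<Rightarrow> 'v) \<Rightarrow> bool" where
  "smooth_section A E U s \<longleftrightarrow>
     (\<forall>x\<in>U. s x \<in> fibre E x) \<and>
     (\<forall>(V, \<psi>)\<in>trivs E. smooth_on A (U \<inter> V) (\<lambda>x. \<psi> x (s x)))"

text \<open>The value on \<open>v\<close> of \<open>\<partial>\<close>bar\<open> s\<close> at \<open>x\<close>, for \<open>v\<close> of type (0,1), computed in a
  holomorphic trivialisation \<open>\<psi>\<close>; it does not depend on \<open>\<psi>\<close>.\<close>

definition dbar_in :: "('x, 'v::ab_group_add, 'r::finite) vbundle \<Rightarrow>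
    ('x \<Rightarrow> 'v \<Rightarrow> complex^'r) \<Rightarrow> ('x \<Rightarrow> 'v) \<Rightarrow> 'x \<Rightarrow> 'x ctangent \<Rightarrow> 'v" where
  "dbar_in E \<psi> s x v = inv_into (fibre E x) (\<psi> x) (\<chi> i. v (\<lambda>y. \<psi> y (s y) $ i))"

section \<open>Hermitian forms, connections and curvature\<close>

definition smooth_hermitian_form :: "('x::topological_space, 'n::finite) chart set \<Rightarrow>
    ('x, 'v::ab_group_add, 'r::finite) vbundle \<Rightarrow> ('x \<Rightarrow> 'v \<Rightarrow> 'v \<Rightarrow> complex) \<Rightarrow> bool" where
  "smooth_hermitian_form A E b \<longleftrightarrow>
     (\<forall>x. \<forall>s\<in>fibre E x. \<forall>t\<in>fibre E x.
        (\<forall>s'\<in>fibre E x. b x (s + s') t = b x s t + b x s' t) \<and>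
        (\<forall>c. b x (vscale E c s) t = c * b x s t) \<and>
        b x t s = cnj (b x s t)) \<and>
     (\<forall>U s t. open U \<longrightarrow> smooth_section A E U s \<longrightarrow> smooth_section A E U t \<longrightarrow>
        smooth_on A U (\<lambda>x. b x (s x) (t x)))"

text \<open>For Hermitian \<open>b\<close> the value \<open>b x s s\<close> is real.\<close>

definition positive_definite :: "('x, 'v::ab_group_add, 'r::finite) vbundle \<Rightarrow>
    ('x \<Rightarrow> 'v \<Rightarrow> 'v \<Rightarrow> complex) \<Rightarrow> bool" where
  "positive_definite E b \<longleftrightarrow> (\<forall>x. \<forall>s\<in>fibre E x. s \<noteq> 0 \<longrightarrow> Re (b x s s) > 0)"

text \<open>A connection acts on smooth sections over arbitrary open sets; \<open>D s x v\<close> is the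
  covariant derivative of \<open>s\<close> at \<open>x\<close> in the direction of the complex tangent vector
  \<open>v\<close>. As sections over \<open>U\<close> are represented by total functions, the last clause says
  that \<open>D s\<close> over \<open>U\<close> only depends on the restriction of \<open>s\<close> to \<open>U\<close> and that
  \<open>D\<close> is compatible with restriction.\<close>

type_synonym ('x, 'v) connect = "('x \<Rightarrow> 'v) \<Rightarrow> 'x \<Rightarrow> 'x ctangent \<Rightarrow> 'v"

definition connection :: "('x::topological_space, 'n::finite) chart set \<Rightarrow>
    ('x, 'v::ab_group_add, 'r::finite) vbundle \<Rightarrow> ('x, 'v) connect \<Rightarrow> bool" where
  "connection A E D \<longleftrightarrow>
     (\<forall>U s. open U \<longrightarrow> smooth_section A E U s \<longrightarrow>
        (\<forall>x\<in>U. \<forall>u\<in>TC A x. \<forall>v\<in>TC A x. \<forall>c.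
           D s x v \<in> fibre E x \<and>
           D s x (\<lambda>f. u f + v f) = D s x u + D s x v \<and>
           D s x (\<lambda>f. c * v f) = vscale E c (D s x v)) \<and>
        (\<forall>\<xi>. smooth_field A U \<xi> \<longrightarrow> smooth_section A E U (\<lambda>x. D s x (\<xi> x))) \<and>
        (\<forall>t. smooth_section A E U t \<longrightarrow>
           (\<forall>x\<in>U. \<forall>v\<in>TC A x. D (\<lambda>y. s y + t y) x v = D s x v + D t x v)) \<and>
        (\<forall>f. smooth_on A U f \<longrightarrow>
           (\<forall>x\<in>U. \<forall>v\<in>TC A x. D (\<lambda>y. vscale E (f y) (s y)) x v =
              vscale E (v f) (s x) + vscale E (f x) (D s x v))) \<and>
        (\<forall>t. smooth_section A E U t \<longrightarrow> (\<forall>y\<in>U. s y = t y) \<longrightarrow>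
           (\<forall>x\<in>U. \<forall>v\<in>TC A x. D s x v = D t x v)))"

text \<open>The 1-form conj\<open>(D t)\<close> takes the value conj\<open>(D t (\<close>conj\<open> v))\<close> on a complex
  tangent vector \<open>v\<close>, hence the \<open>conj_vec\<close> in the compatibility with \<open>b\<close>.\<close>

definition chern_connection :: "('x::topological_space, 'n::finite) chart set \<Rightarrow>
    ('x, 'v::ab_group_add, 'r::finite) vbundle \<Rightarrow> ('x \<Rightarrow> 'v \<Rightarrow> 'v \<Rightarrow> complex) \<Rightarrow>
    ('x, 'v) connect \<Rightarrow> bool" where
  "chern_connection A E b D \<longleftrightarrow>
     connection A E D \<and>
     (\<forall>U s t. open U \<longrightarrow> smooth_section A E U s \<longrightarrow> smooth_section A E U t \<longrightarrow>
        (\<forall>x\<in>U. \<forall>v\<in>TC A x.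
           v (\<lambda>y. b y (s y) (t y)) = b x (D s x v) (t x) + b x (s x) (D t x (conj_vec v)))) \<and>
     (\<forall>U s. open U \<longrightarrow> smooth_section A E U s \<longrightarrow>
        (\<forall>x\<in>U. \<forall>v\<in>T01 A x. \<forall>(V, \<psi>)\<in>trivs E. x \<in> V \<longrightarrow> D s x v = dbar_in E \<psi> s x v))"

text \<open>The extension of \<open>D\<close> to \<open>E\<close>-valued 1-forms, evaluated on vector fields by the
  invariant formula for the exterior covariant derivative. The normalisation is
  \<open>(\<omega> \<and> \<theta>)(\<xi>, \<eta>) = \<omega>(\<xi>) \<theta>(\<eta>) - \<omega>(\<eta>) \<theta>(\<xi>)\<close>, so that \<open>dz\<^sub>j \<and> d\<close>conj\<open>(z\<^sub>k)\<close> takes the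
  value \<open>\<alpha>\<^sub>j\<close>conj\<open>(\<beta>\<^sub>k)\<close> on \<open>(\<alpha>, \<close>conj\<open> \<beta>)\<close>.\<close>

definition ext_cov_deriv :: "('x::topological_space, 'n::finite) chart set \<Rightarrow>
    ('x, 'v::ab_group_add) connect \<Rightarrow> ('x \<Rightarrow> 'x ctangent \<Rightarrow> 'v) \<Rightarrow>
    ('x \<Rightarrow> 'x ctangent) \<Rightarrow> ('x \<Rightarrow> 'x ctangent) \<Rightarrow> 'x \<Rightarrow> 'v" where
  "ext_cov_deriv A D \<omega> \<xi> \<eta> x =
     D (\<lambda>y. \<omega> y (\<eta> y)) x (\<xi> x) - D (\<lambda>y. \<omega> y (\<xi> y)) x (\<eta> x) - \<omega> x (lie_bracket A \<xi> \<eta> x)"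

definition curvature_tensor_of :: "('x::topological_space, 'n::finite) chart set \<Rightarrow>
    ('x \<Rightarrow> 'v::ab_group_add \<Rightarrow> 'v \<Rightarrow> complex) \<Rightarrow> ('x, 'v) connect \<Rightarrow>
    ('x \<Rightarrow> 'x ctangent) \<Rightarrow> ('x \<Rightarrow> 'x ctangent) \<Rightarrow> ('x \<Rightarrow> 'v) \<Rightarrow> ('x \<Rightarrow> 'v) \<Rightarrow> 'x \<Rightarrow> complex" where
  "curvature_tensor_of A b D \<alpha> \<beta> s t x =
     b x (ext_cov_deriv A D (D s) \<alpha> (\<lambda>y. conj_vec (\<beta> y)) x) (t x)"

text \<open>The value does not depend on the choice of the Chern connection.\<close>

definition curvature_tensor :: "('x::topological_space, 'n::finite) chart set \<Rightarrow>
    ('x, 'v::ab_group_add, 'r::finite) vbundle \<Rightarrow> ('x \<Rightarrow> 'v \<Rightarrow> 'v \<Rightarrow> complex) \<Rightarrow>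
    ('x \<Rightarrow> 'x ctangent) \<Rightarrow> ('x \<Rightarrow> 'x ctangent) \<Rightarrow> ('x \<Rightarrow> 'v) \<Rightarrow> ('x \<Rightarrow> 'v) \<Rightarrow> 'x \<Rightarrow> complex" where
  "curvature_tensor A E b = curvature_tensor_of A b (SOME D. chern_connection A E b D)"

section \<open>The form \<open>q\<close> and the difference of two connections\<close>

text \<open>\<open>inv_comp E h b\<close> is the endomorphism \<open>h\<^sup>-\<^sup>1 b\<close>.\<close>

definition inv_comp :: "('x, 'v::ab_group_add, 'r::finite) vbundle \<Rightarrow>
    ('x \<Rightarrow> 'v \<Rightarrow> 'v \<Rightarrow> complex) \<Rightarrow> ('x \<Rightarrow> 'v \<Rightarrow> 'v \<Rightarrow> complex) \<Rightarrow> 'x \<Rightarrow> 'v \<Rightarrow> 'v" where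
  "inv_comp E h b x s = (THE u. u \<in> fibre E x \<and> (\<forall>t\<in>fibre E x. h x u t = b x s t))"

definition q_form :: "('x, 'v::ab_group_add, 'r::finite) vbundle \<Rightarrow>
    ('x \<Rightarrow> 'v \<Rightarrow> 'v \<Rightarrow> complex) \<Rightarrow> ('x \<Rightarrow> 'v \<Rightarrow> 'v \<Rightarrow> complex) \<Rightarrow>
    ('x \<Rightarrow> 'v \<Rightarrow> 'v \<Rightarrow> complex) \<Rightarrow> 'x \<Rightarrow> 'v \<Rightarrow> 'v \<Rightarrow> complex" where
  "q_form E h b1 b2 x s t =
     b1 x (inv_comp E h b2 x s) (inv_comp E h b2 x t) +
     b2 x (inv_comp E h b1 x s) (inv_comp E h b1 x t)"

definition conn_diff :: "('x, 'v::ab_group_add) connect \<Rightarrow> ('x, 'v) connect \<Rightarrow>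
    ('x \<Rightarrow> 'x ctangent) \<Rightarrow> ('x \<Rightarrow> 'v) \<Rightarrow> 'x \<Rightarrow> 'v" where
  "conn_diff D1 D2 \<alpha> s x = D1 s x (\<alpha> x) - D2 s x (\<alpha> x)"

end

theory Submission
  imports Defs "HOL-Complex_Analysis.Cauchy_Integral_Formula"
begin

text \<open>Write \<open>D\<^sub>1\<close>, \<open>D\<^sub>2\<close>, \<open>D\<close> for Chern connections of \<open>b\<^sub>1\<close>, \<open>b\<^sub>2\<close>, \<open>h\<close>. All of them restrict to
the same operator on vectors of type (0,1), and compatibility with the form then determines
\<open>b(D\<^sub>v s, t)\<close> for \<open>v\<close> of type (1,0) as \<open>v(b(s, t)) - b(s, \<partial>\<close>bar\<open> t)\<close>, an expression that is
additive in \<open>b\<close>. Hence \<open>h(D\<^sub>v s, t) = b\<^sub>1(D\<^sub>1\<^sub>v s, t) + b\<^sub>2(D\<^sub>2\<^sub>v s, t)\<close> (lemma \<open>chern_sum\<close>).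
Read as a definition of \<open>D\<close>, this identity gives \<open>h\<close> the Chern connection \<open>h\<^sup>-\<^sup>1 b\<^sub>1 D\<^sub>1 + h\<^sup>-\<^sup>1 b\<^sub>2 D\<^sub>2\<close>
(lemma \<open>chern_connection_exists\<close>), so that its curvature tensor is meaningful.

For \<open>\<eta> = \<close>conj\<open>(\<beta>)\<close> the curvature tensor of \<open>b\<close> is the \<open>b\<close>-product of
\<open>D\<^sub>\<alpha> D\<^sub>\<eta> s - D\<^sub>\<eta> D\<^sub>\<alpha> s - D\<^sub>[\<^sub>\<alpha>\<^sub>,\<^sub>\<eta>\<^sub>] s\<close> with \<open>t\<close>. Moving \<open>D\<^sub>\<eta>\<close> to the other side turns the middle term
into \<open>- \<eta>(b(D\<^sub>\<alpha> s, t)) + b(D\<^sub>\<alpha> s, D\<^sub>\<beta> t)\<close>. Every term except the last one is additive in \<open>b\<close> by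
\<open>chern_sum\<close>; the bracket term uses that the bracket of two smooth fields is again a tangent
vector. Therefore (lemma \<open>curvature_sum\<close>) the defect of additivity of the curvature tensor is
\<open>h(D\<^sub>\<alpha> s, D\<^sub>\<beta> t) - b\<^sub>1(D\<^sub>1\<^sub>\<alpha> s, D\<^sub>1\<^sub>\<beta> t) - b\<^sub>2(D\<^sub>2\<^sub>\<alpha> s, D\<^sub>2\<^sub>\<beta> t)\<close>, and since
\<open>D\<^sub>1 - D = h\<^sup>-\<^sup>1 b\<^sub>2 \<sigma>\<close> and \<open>D - D\<^sub>2 = h\<^sup>-\<^sup>1 b\<^sub>1 \<sigma>\<close>, a computation in one fibre identifies
it with \<open>- q(\<sigma>(\<alpha>) s, \<sigma>(\<beta>) t)\<close> (lemma \<open>hermitian_sum_defect\<close>).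
If \<open>b\<^sub>1\<close> or \<open>b\<^sub>2\<close> is degenerate, its curvature tensor may be computed from a connection other than
the given one; the two differ only by sections of the kernel of the form (lemma \<open>chern_unique\<close>).

The analytic input is that there are enough smooth objects for these pointwise identities to be
tested: every vector of a fibre extends to a smooth local section, coordinates are smooth
functions, \<open>h\<^sup>-\<^sup>1 b\<close> preserves smoothness, and \<open>[\<alpha>, \<eta>]\<close> is a derivation of first order. The first
two rest on the smoothness of merely complex differentiable maps of several variables (the
Cauchy integral formula along complex lines), the third on Cramer's rule, and the last on the
symmetry of second derivatives.\<close>

section \<open>Calculus of \<open>C\<^sup>k\<close> functions\<close>

lemma frechet_derivative_cong_open:
  assumes "open S" "x \<in> S" "\<And>y. y \<in> S \<Longrightarrow> f y = g y"
  shows "frechet_derivative f (at x) = frechet_derivative g (at x)"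
proof -
  have "(f has_derivative F) (at x) \<longleftrightarrow> (g has_derivative F) (at x)" for F
    using has_derivative_transform_within_open[of f F x UNIV S g]
      has_derivative_transform_within_open[of g F x UNIV S f] assms by auto
  then show ?thesis unfolding frechet_derivative_def by simp
qed

lemma Ck_on_has_derivative:
  assumes "Ck_on (Suc k) S f" "x \<in> S"
  shows "(f has_derivative frechet_derivative f (at x)) (at x)"
proof -
  have "f differentiable (at x)" using assms by simp
  then show ?thesis by (simp add: frechet_derivative_works)
qed

lemma Ck_on_cong:
  assumes "open S" "\<And>x. x \<in> S \<Longrightarrow> f x = g x" "Ck_on k S f"
  shows "Ck_on k S g"
  using assms(2,3)
proof (induction k arbitrary: f g)
  case 0
  then show ?case by (auto cong: continuous_on_cong)
next
  case (Suc k)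
  have "g differentiable (at x)" if "x \<in> S" for x
  proof -
    from has_derivative_transform_within_open[OF Ck_on_has_derivative[OF Suc.prems(2) that]
        assms(1) that Suc.prems(1)]
    show ?thesis by (rule differentiableI)
  qed
  moreover have "Ck_on k S (\<lambda>x. frechet_derivative g (at x) v)" for v
  proof (rule Suc.IH)
    show "frechet_derivative f (at x) v = frechet_derivative g (at x) v" if "x \<in> S" for x
      using frechet_derivative_cong_open[OF assms(1) that Suc.prems(1)] by simp
    show "Ck_on k S (\<lambda>x. frechet_derivative f (at x) v)" using Suc.prems(2) by simp
  qed
  ultimately show ?case by simp
qed

lemma Ck_on_SucD:
  assumes "Ck_on (Suc k) S f"
  shows "Ck_on k S f"
  using assms
proof (induction k arbitrary: f)
  case 0
  then show ?case
    by (auto intro!: continuous_at_imp_continuous_on differentiable_imp_continuous_within)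
next
  case (Suc k)
  then show ?case by auto
qed

text \<open>The recursion defining \<open>C\<^sup>k\<close> refers to the chosen value \<open>frechet_derivative\<close>. By uniqueness of
derivatives, a closure property of \<open>C\<^sup>k\<close> only has to exhibit some derivative.\<close>

lemma Ck_on_SucI:
  assumes "open S" "\<And>x. x \<in> S \<Longrightarrow> (f has_derivative F x) (at x)" "\<And>v. Ck_on k S (\<lambda>x. F x v)"
  shows "Ck_on (Suc k) S f"
proof -
  have "Ck_on k S (\<lambda>x. frechet_derivative f (at x) v)" for v
    by (rule Ck_on_cong[OF assms(1) _ assms(3)[of v]])
       (simp add: frechet_derivative_at[OF assms(2), symmetric])
  then show ?thesis using assms(2)[THEN differentiableI] by auto
qed

lemma Ck_on_subset:
  assumes "Ck_on k S f" "T \<subseteq> S"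
  shows "Ck_on k T f"
  using assms(1) by (induction k arbitrary: f) (use assms(2) in \<open>auto intro: continuous_on_subset\<close>)

lemma Ck_on_const: "Ck_on k S (\<lambda>x. c)"
  by (induction k arbitrary: c) auto

lemma Ck_on_bounded_linear:
  assumes "open S" "bounded_linear B" "Ck_on k S f"
  shows "Ck_on k S (\<lambda>x. B (f x))"
  using assms(3)
proof (induction k arbitrary: f)
  case 0
  then show ?case
    using assms(2) by (auto intro: bounded_linear.continuous_on)
next
  case (Suc k)
  show ?case
    by (rule Ck_on_SucI[OF assms(1)
          bounded_linear.has_derivative[OF assms(2) Ck_on_has_derivative[OF Suc.prems]] Suc.IH])
       (use Suc.prems in auto)
qed

lemma Ck_on_add:
  assumes "open S" "Ck_on k S f" "Ck_on k S g"
  shows "Ck_on k S (\<lambda>x. f x + g x)"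
  using assms(2,3)
proof (induction k arbitrary: f g)
  case 0
  then show ?case by (auto intro: continuous_intros)
next
  case (Suc k)
  show ?case
    by (rule Ck_on_SucI[OF assms(1) has_derivative_add[OF Ck_on_has_derivative[OF Suc.prems(1)]
          Ck_on_has_derivative[OF Suc.prems(2)]] Suc.IH]) (use Suc.prems in auto)
qed

lemma Ck_on_bounded_bilinear:
  assumes "open S" "bounded_bilinear B" "Ck_on k S f" "Ck_on k S g"
  shows "Ck_on k S (\<lambda>x. B (f x) (g x))"
  using assms(3,4)
proof (induction k arbitrary: f g)
  case 0
  then show ?case using bounded_bilinear.continuous_on[OF assms(2)] by auto
next
  case (Suc k)
  show ?case
    by (rule Ck_on_SucI[OF assms(1) bounded_bilinear.FDERIV[OF assms(2)
          Ck_on_has_derivative[OF Suc.prems(1)] Ck_on_has_derivative[OF Suc.prems(2)]]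
          Ck_on_add[OF assms(1) Suc.IH Suc.IH]])
       (use Suc.prems Ck_on_SucD[OF Suc.prems(1)] Ck_on_SucD[OF Suc.prems(2)] in auto)
qed

lemma Ck_on_inverse:
  fixes f :: "'a::real_normed_vector \<Rightarrow> complex"
  assumes "open S" "Ck_on k S f" "\<And>x. x \<in> S \<Longrightarrow> f x \<noteq> 0"
  shows "Ck_on k S (\<lambda>x. inverse (f x))"
  using assms(2)
proof (induction k)
  case 0
  then show ?case using assms(3) by (auto intro!: continuous_intros)
next
  case (Suc k)
  have I: "Ck_on k S (\<lambda>x. inverse (f x))"
    by (rule Suc.IH[OF Ck_on_SucD[OF Suc.prems]])
  have "Ck_on k S (\<lambda>x. inverse (f x) * frechet_derivative f (at x) v * inverse (f x))" for v
    by (intro Ck_on_bounded_bilinear[OF assms(1) bounded_bilinear_mult] I) (use Suc.prems in auto)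
  note D = Ck_on_bounded_linear[OF assms(1) bounded_linear_minus[OF bounded_linear_ident] this]
  show ?case
    by (rule Ck_on_SucI[OF assms(1) Deriv.has_derivative_inverse[OF assms(3)
          Ck_on_has_derivative[OF Suc.prems]] D])
qed

lemma Ck_on_mult:
  fixes f g :: "'a::real_normed_vector \<Rightarrow> complex"
  assumes "open S" "Ck_on k S f" "Ck_on k S g"
  shows "Ck_on k S (\<lambda>x. f x * g x)"
  by (rule Ck_on_bounded_bilinear[OF assms(1) bounded_bilinear_mult assms(2,3)])

lemma Ck_on_sum:
  assumes "open S" "\<And>i. i \<in> I \<Longrightarrow> Ck_on k S (f i)"
  shows "Ck_on k S (\<lambda>x. \<Sum>i\<in>I. f i x)"
  using assms(2)
proof (induction I rule: infinite_finite_induct)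
  case (insert i I)
  then show ?case using Ck_on_add[OF assms(1), of k "f i" "\<lambda>x. \<Sum>i\<in>I. f i x"] by simp
qed (simp_all add: Ck_on_const)

lemma Ck_on_prod:
  fixes f :: "'i \<Rightarrow> 'a::real_normed_vector \<Rightarrow> complex"
  assumes "open S" "\<And>i. i \<in> I \<Longrightarrow> Ck_on k S (f i)"
  shows "Ck_on k S (\<lambda>x. \<Prod>i\<in>I. f i x)"
  using assms(2)
proof (induction I rule: infinite_finite_induct)
  case (insert i I)
  then show ?case using Ck_on_mult[OF assms(1), of k "f i" "\<lambda>x. \<Prod>i\<in>I. f i x"] by simp
qed (simp_all add: Ck_on_const)

lemma Ck_on_vec:
  fixes f :: "'a::real_normed_vector \<Rightarrow> complex^'m::finite"
  assumes "open S" "\<And>i. Ck_on k S (\<lambda>x. f x $ i)"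
  shows "Ck_on k S f"
proof -
  have "bounded_linear (\<lambda>z::complex. axis i z)" for i :: 'm
    by (rule linear_conv_bounded_linear[THEN iffD1], rule linearI)
       (auto simp: vec_eq_iff axis_def)
  then have "Ck_on k S (\<lambda>x. \<Sum>i\<in>UNIV. axis i (f x $ i))"
    by (intro Ck_on_sum[OF assms(1)]) (rule Ck_on_bounded_linear[OF assms(1) _ assms(2)])
  moreover have "(\<Sum>i\<in>UNIV. axis i (f x $ i)) = f x" for x
    by (simp add: vec_eq_iff axis_def sum.delta' if_distrib cong: if_cong)
  ultimately show ?thesis by simp
qed

section \<open>Symmetry of second derivatives\<close>

text \<open>The second difference of \<open>f\<close> over the parallelogram spanned by \<open>h u\<close> and \<open>h v\<close> is the increment
over \<open>[0, h]\<close> of \<open>s \<mapsto> f (x + s u + h v) - f (x + s u)\<close>. The mean value theorem in \<open>s\<close>, followed by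
the mean value theorem in the direction of \<open>v\<close>, writes it as a mixed second derivative.\<close>

lemma second_difference_mvt:
  fixes f :: "'a::real_normed_vector \<Rightarrow> real"
  assumes S: "\<And>s t. 0 \<le> s \<Longrightarrow> s \<le> h \<Longrightarrow> 0 \<le> t \<Longrightarrow> t \<le> h \<Longrightarrow> x + s *\<^sub>R u + t *\<^sub>R v \<in> S"
    and f: "\<And>y. y \<in> S \<Longrightarrow> f differentiable (at y)"
    and f': "\<And>y. y \<in> S \<Longrightarrow> (\<lambda>y. frechet_derivative f (at y) u) differentiable (at y)"
    and h: "0 < h"
  shows "\<exists>s t. 0 \<le> s \<and> s \<le> h \<and> 0 \<le> t \<and> t \<le> h \<and>
    f (x + h *\<^sub>R u + h *\<^sub>R v) - f (x + h *\<^sub>R u) - f (x + h *\<^sub>R v) + f x =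
    h * h * frechet_derivative (\<lambda>y. frechet_derivative f (at y) u) (at (x + s *\<^sub>R u + t *\<^sub>R v)) v"
proof -
  define f1 where "f1 y = frechet_derivative f (at y) u" for y
  have df: "((\<lambda>s. f (x + s *\<^sub>R u + t *\<^sub>R v)) has_real_derivative f1 (x + s *\<^sub>R u + t *\<^sub>R v)) (at s)"
    if "0 \<le> s" "s \<le> h" "0 \<le> t" "t \<le> h" for s t
  proof -
    have "(f has_derivative frechet_derivative f (at (x + s *\<^sub>R u + t *\<^sub>R v))) (at (x + s *\<^sub>R u + t *\<^sub>R v))"
      using f S that frechet_derivative_works by blast
    note D = this
    have "((\<lambda>s. x + s *\<^sub>R u + t *\<^sub>R v) has_derivative (\<lambda>r. r *\<^sub>R u)) (at s)"
      by (auto intro!: derivative_eq_intros)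
    from has_derivative_compose[OF this D]
    have "((\<lambda>s. f (x + s *\<^sub>R u + t *\<^sub>R v)) has_derivative
        (\<lambda>r. frechet_derivative f (at (x + s *\<^sub>R u + t *\<^sub>R v)) (r *\<^sub>R u))) (at s)" .
    moreover have "linear (frechet_derivative f (at (x + s *\<^sub>R u + t *\<^sub>R v)))"
      using f S that linear_frechet_derivative by blast
    ultimately show ?thesis
      by (simp add: has_field_derivative_def f1_def linear_cmul mult_commute_abs)
  qed
  have df1: "((\<lambda>t. f1 (x + s *\<^sub>R u + t *\<^sub>R v)) has_real_derivative
      frechet_derivative f1 (at (x + s *\<^sub>R u + t *\<^sub>R v)) v) (at t)"
    if "0 \<le> s" "s \<le> h" "0 \<le> t" "t \<le> h" for s t
  proof -
    have D: "f1 differentiable (at (x + s *\<^sub>R u + t *\<^sub>R v))"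
      unfolding f1_def using f' S that by blast
    then have "(f1 has_derivative frechet_derivative f1 (at (x + s *\<^sub>R u + t *\<^sub>R v))) (at (x + s *\<^sub>R u + t *\<^sub>R v))"
      using frechet_derivative_works by blast
    note D' = this
    have "((\<lambda>t. x + s *\<^sub>R u + t *\<^sub>R v) has_derivative (\<lambda>r. r *\<^sub>R v)) (at t)"
      by (auto intro!: derivative_eq_intros)
    from has_derivative_compose[OF this D']
    have "((\<lambda>t. f1 (x + s *\<^sub>R u + t *\<^sub>R v)) has_derivative
        (\<lambda>r. frechet_derivative f1 (at (x + s *\<^sub>R u + t *\<^sub>R v)) (r *\<^sub>R v))) (at t)" .
    moreover have "linear (frechet_derivative f1 (at (x + s *\<^sub>R u + t *\<^sub>R v)))"
      using D linear_frechet_derivative by blast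
    ultimately show ?thesis
      by (simp add: has_field_derivative_def linear_cmul mult_commute_abs)
  qed
  have "\<exists>s>0. s < h \<and>
     (f (x + h *\<^sub>R u + h *\<^sub>R v) - f (x + h *\<^sub>R u + 0 *\<^sub>R v)) - (f (x + 0 *\<^sub>R u + h *\<^sub>R v) - f (x + 0 *\<^sub>R u + 0 *\<^sub>R v)) =
     (h - 0) * (f1 (x + s *\<^sub>R u + h *\<^sub>R v) - f1 (x + s *\<^sub>R u + 0 *\<^sub>R v))"
    by (rule MVT2[OF h, of "\<lambda>s. f (x + s *\<^sub>R u + h *\<^sub>R v) - f (x + s *\<^sub>R u + 0 *\<^sub>R v)"
          "\<lambda>s. f1 (x + s *\<^sub>R u + h *\<^sub>R v) - f1 (x + s *\<^sub>R u + 0 *\<^sub>R v)"])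
       (use h in \<open>auto intro!: DERIV_diff df[of _ h] df[of _ 0, simplified]\<close>)
  then obtain s where s: "0 < s" "s < h" and s_eq:
    "f (x + h *\<^sub>R u + h *\<^sub>R v) - f (x + h *\<^sub>R u) - f (x + h *\<^sub>R v) + f x =
      h * (f1 (x + s *\<^sub>R u + h *\<^sub>R v) - f1 (x + s *\<^sub>R u))"
    by auto
  have "\<exists>t>0. t < h \<and> f1 (x + s *\<^sub>R u + h *\<^sub>R v) - f1 (x + s *\<^sub>R u + 0 *\<^sub>R v) =
     (h - 0) * frechet_derivative f1 (at (x + s *\<^sub>R u + t *\<^sub>R v)) v"
    by (rule MVT2[OF h]) (use s in \<open>auto intro!: df1\<close>)
  then obtain t where t: "0 < t" "t < h" and t_eq:
    "f1 (x + s *\<^sub>R u + h *\<^sub>R v) - f1 (x + s *\<^sub>R u) =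
      h * frechet_derivative f1 (at (x + s *\<^sub>R u + t *\<^sub>R v)) v"
    by auto
  show ?thesis
    by (rule exI[of _ s], rule exI[of _ t]) (use s t s_eq t_eq in \<open>simp add: f1_def[abs_def]\<close>)
qed

text \<open>The second difference is symmetric in \<open>u\<close> and \<open>v\<close>, so each small parallelogram contains a point for
each order of differentiation at which the two mixed derivatives agree; shrink the parallelogram and
use continuity.\<close>

lemma second_derivative_symmetric_real:
  fixes f :: "'a::real_normed_vector \<Rightarrow> real"
  assumes S: "open S" "x \<in> S" and C2: "Ck_on 2 S f"
  shows "frechet_derivative (\<lambda>y. frechet_derivative f (at y) u) (at x) v =
         frechet_derivative (\<lambda>y. frechet_derivative f (at y) v) (at x) u"
proof -
  define F where "F u v y = frechet_derivative (\<lambda>y. frechet_derivative f (at y) u) (at y) v" for u v y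
  have f: "f differentiable (at y)" if "y \<in> S" for y
    using C2 that by (simp add: numeral_2_eq_2)
  have f': "(\<lambda>y. frechet_derivative f (at y) w) differentiable (at y)" if "y \<in> S" for y w
    using C2 that by (simp add: numeral_2_eq_2)
  have cont: "continuous_on S (F u v)" for u v
    using C2 unfolding F_def by (simp add: numeral_2_eq_2)
  have "dist (F u v x) (F v u x) \<le> 0 + e" if e: "e > 0" for e
  proof -
    have "\<exists>d>0. \<forall>y. dist y x < d \<longrightarrow> y \<in> S \<and> dist (F u v y) (F u v x) < e / 2 \<and> dist (F v u y) (F v u x) < e / 2"
    proof -
      have "\<forall>\<^sub>F y in nhds x. y \<in> S" using S by (rule eventually_nhds_in_open)
      moreover have "\<forall>\<^sub>F y in nhds x. dist (F u v y) (F u v x) < e / 2" for u v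
        using cont[of u v] S e
        by (intro tendstoD) (auto simp: continuous_on_eq_continuous_at continuous_at tendsto_at_iff_tendsto_nhds)
      ultimately have "\<forall>\<^sub>F y in nhds x. y \<in> S \<and> dist (F u v y) (F u v x) < e / 2 \<and> dist (F v u y) (F v u x) < e / 2"
        by (intro eventually_conj)
      then show ?thesis by (simp add: eventually_nhds_metric)
    qed
    then obtain d where d: "d > 0" and near: "\<And>y. dist y x < d \<Longrightarrow>
        y \<in> S \<and> dist (F u v y) (F u v x) < e / 2 \<and> dist (F v u y) (F v u x) < e / 2"
      by blast
    define N where "N = norm u + norm v + 1"
    define h where "h = d / (2 * N)"
    have pos: "0 < N" unfolding N_def using norm_ge_zero[of u] norm_ge_zero[of v] by linarith
    have h: "h > 0" unfolding h_def using d pos by simp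
    have small: "dist (x + s *\<^sub>R u + t *\<^sub>R v) x < d"
      if "0 \<le> s" "s \<le> h" "0 \<le> t" "t \<le> h" for s t
    proof -
      have "dist (x + s *\<^sub>R u + t *\<^sub>R v) x = norm (s *\<^sub>R u + t *\<^sub>R v)"
        by (simp add: dist_norm algebra_simps)
      also have "\<dots> \<le> s * norm u + t * norm v"
        using norm_triangle_ineq[of "s *\<^sub>R u" "t *\<^sub>R v"] that by simp
      also have "\<dots> \<le> h * norm u + h * norm v"
        using that by (intro add_mono mult_right_mono) auto
      also have "\<dots> \<le> h * N" using h by (simp add: N_def algebra_simps)
      also have "\<dots> = d / 2" unfolding h_def using pos by simp
      also have "\<dots> < d" using d by simp
      finally show ?thesis .
    qed
    obtain s t where st: "0 \<le> s" "s \<le> h" "0 \<le> t" "t \<le> h"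
      "f (x + h *\<^sub>R u + h *\<^sub>R v) - f (x + h *\<^sub>R u) - f (x + h *\<^sub>R v) + f x =
       h * h * F u v (x + s *\<^sub>R u + t *\<^sub>R v)"
      using second_difference_mvt[of h x u v S f] near small f f' h unfolding F_def by blast
    have small': "dist (x + s *\<^sub>R v + t *\<^sub>R u) x < d"
      if "0 \<le> s" "s \<le> h" "0 \<le> t" "t \<le> h" for s t
      using small[of t s] that by (simp add: algebra_simps)
    obtain s' t' where st': "0 \<le> s'" "s' \<le> h" "0 \<le> t'" "t' \<le> h"
      "f (x + h *\<^sub>R v + h *\<^sub>R u) - f (x + h *\<^sub>R v) - f (x + h *\<^sub>R u) + f x =
       h * h * F v u (x + s' *\<^sub>R v + t' *\<^sub>R u)"
      using second_difference_mvt[of h x v u S f] near small' f f' h unfolding F_def by blast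
    have "x + h *\<^sub>R u + h *\<^sub>R v = x + h *\<^sub>R v + h *\<^sub>R u" by (simp add: algebra_simps)
    then have "h * h * F u v (x + s *\<^sub>R u + t *\<^sub>R v) = h * h * F v u (x + s' *\<^sub>R v + t' *\<^sub>R u)"
      using st(5) st'(5) by (simp add: algebra_simps)
    then have "F u v (x + s *\<^sub>R u + t *\<^sub>R v) = F v u (x + s' *\<^sub>R v + t' *\<^sub>R u)"
      using h by simp
    moreover have "dist (F u v (x + s *\<^sub>R u + t *\<^sub>R v)) (F u v x) < e / 2"
      using near small st by blast
    moreover have "dist (F v u (x + s' *\<^sub>R v + t' *\<^sub>R u)) (F v u x) < e / 2"
      using near small' st' by blast
    ultimately show ?thesis by (simp add: dist_real_def abs_if split: if_splits)
  qed
  then have "dist (F u v x) (F v u x) \<le> 0" by (rule field_le_epsilon)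
  then show ?thesis unfolding F_def by simp
qed

lemma frechet_derivative_bounded_linear:
  assumes "bounded_linear B" "f differentiable (at x)"
  shows "frechet_derivative (\<lambda>y. B (f y)) (at x) v = B (frechet_derivative f (at x) v)"
  using frechet_derivative_at[OF bounded_linear.has_derivative[OF assms(1)
      frechet_derivative_works[THEN iffD1, OF assms(2)]]] by (rule fun_cong[OF sym])

lemma second_derivative_symmetric:
  fixes f :: "'a::real_normed_vector \<Rightarrow> complex"
  assumes S: "open S" "x \<in> S" and C2: "Ck_on 2 S f"
  shows "frechet_derivative (\<lambda>y. frechet_derivative f (at y) u) (at x) v =
         frechet_derivative (\<lambda>y. frechet_derivative f (at y) v) (at x) u"
proof -
  have *: "B (frechet_derivative (\<lambda>y. frechet_derivative f (at y) u) (at x) v) =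
      frechet_derivative (\<lambda>y. frechet_derivative (\<lambda>z. B (f z)) (at y) u) (at x) v"
    if B: "bounded_linear B" for B :: "complex \<Rightarrow> real" and u v
  proof -
    have f: "f differentiable (at y)" if "y \<in> S" for y
      using C2 that by (simp add: numeral_2_eq_2)
    have "(\<lambda>y. frechet_derivative f (at y) u) differentiable (at x)"
      using C2 S by (simp add: numeral_2_eq_2)
    from frechet_derivative_bounded_linear[OF B this, of v]
    have "B (frechet_derivative (\<lambda>y. frechet_derivative f (at y) u) (at x) v) =
        frechet_derivative (\<lambda>y. B (frechet_derivative f (at y) u)) (at x) v" by simp
    also have "frechet_derivative (\<lambda>y. B (frechet_derivative f (at y) u)) (at x) =
        frechet_derivative (\<lambda>y. frechet_derivative (\<lambda>z. B (f z)) (at y) u) (at x)"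
      by (rule frechet_derivative_cong_open[OF S])
         (use frechet_derivative_bounded_linear[OF B f] in simp)
    finally show ?thesis .
  qed
  have "B (frechet_derivative (\<lambda>y. frechet_derivative f (at y) u) (at x) v) =
        B (frechet_derivative (\<lambda>y. frechet_derivative f (at y) v) (at x) u)"
    if B: "bounded_linear B" for B :: "complex \<Rightarrow> real"
    unfolding *[OF B]
    by (rule second_derivative_symmetric_real[OF S Ck_on_bounded_linear[OF S(1) B C2]])
  from this[OF bounded_linear_Re] this[OF bounded_linear_Im] show ?thesis
    by (simp add: complex_eq_iff)
qed

section \<open>Holomorphic maps are smooth\<close>

lemma bounded_linear_vector_scalar_mult: "bounded_linear (\<lambda>c. c *s (v :: complex^'n::finite))"
  by (rule linear_conv_bounded_linear[THEN iffD1], rule linearI)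
     (auto simp: vec_eq_iff algebra_simps)

lemma norm_vector_scalar_mult: "norm (c *s (v :: complex^'n::finite)) = norm c * norm v"
  unfolding norm_vec_def by (simp add: L2_set_def norm_mult power_mult_distrib
      sum_distrib_left[symmetric] real_sqrt_mult)

text \<open>Scalar version of \<open>holo_map_on\<close>, so that the one-variable Cauchy formula applies to the components
of a map.\<close>

definition holomorphic_fun_on :: "(complex^'n::finite) set \<Rightarrow> (complex^'n \<Rightarrow> complex) \<Rightarrow> bool" where
  "holomorphic_fun_on S g \<longleftrightarrow>
     (\<forall>z\<in>S. \<exists>L. (g has_derivative L) (at z) \<and> (\<forall>c v. L (c *s v) = c * L v))"

lemma holomorphic_fun_onD:
  assumes "holomorphic_fun_on S g" "z \<in> S"
  shows "(g has_derivative frechet_derivative g (at z)) (at z)"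
    and "frechet_derivative g (at z) (c *s v) = c * frechet_derivative g (at z) v"
proof -
  obtain L where L: "(g has_derivative L) (at z)" "\<forall>c v. L (c *s v) = c * L v"
    using assms unfolding holomorphic_fun_on_def by blast
  then have "L = frechet_derivative g (at z)" using frechet_derivative_at by blast
  then show "(g has_derivative frechet_derivative g (at z)) (at z)"
    "frechet_derivative g (at z) (c *s v) = c * frechet_derivative g (at z) v" using L by auto
qed

lemma circlepath_0_nonzero:
  assumes "\<rho> > 0"
  shows "norm (circlepath 0 \<rho> t) = \<rho>" "circlepath 0 \<rho> t \<noteq> 0"
proof -
  show *: "norm (circlepath 0 \<rho> t) = \<rho>"
    using assms by (simp add: circlepath norm_mult norm_exp_eq_Re)
  show "circlepath 0 \<rho> t \<noteq> 0" using * assms by auto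
qed

text \<open>The Cauchy formula for the first derivative at \<open>0\<close> of \<open>\<zeta> \<mapsto> g (z + \<zeta> v)\<close>. The derivative of the
parametrised circle is \<open>2\<pi>\<i>\<close> times the circle, which cancels one factor of the squared denominator.\<close>

lemma holomorphic_directional_derivative_integral:
  fixes g :: "complex^'n::finite \<Rightarrow> complex"
  assumes g: "holomorphic_fun_on S g" and \<rho>: "\<rho> > 0"
    and S: "\<And>\<zeta>. norm \<zeta> \<le> \<rho> \<Longrightarrow> z + \<zeta> *s v \<in> S"
  shows "frechet_derivative g (at z) v =
    integral {0..1} (\<lambda>t. g (z + circlepath 0 \<rho> t *s v) / circlepath 0 \<rho> t)"
proof -
  define F where "F \<zeta> = g (z + \<zeta> *s v)" for \<zeta>
  have F: "(F has_field_derivative frechet_derivative g (at (z + \<zeta> *s v)) v) (at \<zeta>)"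
    if "norm \<zeta> \<le> \<rho>" for \<zeta>
  proof -
    have "((\<lambda>\<zeta>. z + \<zeta> *s v) has_derivative (\<lambda>\<zeta>. \<zeta> *s v)) (at \<zeta>)"
      using bounded_linear_imp_has_derivative[OF bounded_linear_vector_scalar_mult]
      by (auto intro!: derivative_eq_intros)
    from has_derivative_compose[OF this holomorphic_fun_onD(1)[OF g S[OF that]]]
    show ?thesis unfolding F_def has_field_derivative_def
      by (simp add: holomorphic_fun_onD(2)[OF g S[OF that]] mult_commute_abs)
  qed
  have cont: "continuous_on (cball 0 \<rho>) F"
    by (rule DERIV_continuous_on) (use F in \<open>auto intro: has_field_derivative_at_within\<close>)
  have hol: "F holomorphic_on ball 0 \<rho>"
    by (rule holomorphic_onI)
       (use F field_differentiable_at_within field_differentiable_def less_imp_le in fastforce)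
  have "(F has_field_derivative (1 / (2 * of_real pi * \<i>) *
      contour_integral (circlepath 0 \<rho>) (\<lambda>u. F u / (u - 0)^2))) (at 0)"
    by (rule Cauchy_derivative_integral_circlepath[OF cont hol]) (use \<rho> in auto)
  then have "frechet_derivative g (at z) v =
      1 / (2 * of_real pi * \<i>) * contour_integral (circlepath 0 \<rho>) (\<lambda>u. F u / (u - 0)^2)"
    using F[of 0] \<rho> DERIV_unique by fastforce
  also have "\<dots> = integral {0..1} (\<lambda>t. 1 / (2 * of_real pi * \<i>) *
      (F (circlepath 0 \<rho> t) / (circlepath 0 \<rho> t)^2 * vector_derivative (circlepath 0 \<rho>) (at t)))"
    unfolding contour_integral_integral by (simp only: integral_mult_right diff_zero)
  also have "\<dots> = integral {0..1} (\<lambda>t. F (circlepath 0 \<rho> t) / circlepath 0 \<rho> t)"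
  proof (rule integral_cong)
    fix t :: real
    have "vector_derivative (circlepath 0 \<rho>) (at t) = 2 * of_real pi * \<i> * circlepath 0 \<rho> t"
      by (simp only: vector_derivative_circlepath) (simp add: circlepath)
    then show "1 / (2 * of_real pi * \<i>) *
      (F (circlepath 0 \<rho> t) / (circlepath 0 \<rho> t)^2 * vector_derivative (circlepath 0 \<rho>) (at t)) =
      F (circlepath 0 \<rho> t) / circlepath 0 \<rho> t"
      using circlepath_0_nonzero[OF \<rho>, of t] by (simp add: field_simps power2_eq_square)
  qed
  finally show ?thesis unfolding F_def .
qed

lemma holomorphic_fun_on_continuous:
  assumes "holomorphic_fun_on S g"
  shows "continuous_on S g"
  using assms unfolding holomorphic_fun_on_def
  by (meson continuous_at_imp_continuous_on has_derivative_continuous)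

text \<open>One radius \<open>\<rho>\<close> serves for all centres in the smaller ball, as needed for differentiating the
integral with respect to the centre.\<close>

lemma circle_translates_in_ball:
  assumes "0 \<le> \<rho>" "\<rho> * norm v < r" "z \<in> ball z0 r" "norm \<zeta> \<le> \<rho>"
  shows "z + \<zeta> *s (v :: complex^'n::finite) \<in> ball z0 (2 * r)"
proof -
  have "dist z0 (z + \<zeta> *s v) \<le> dist z0 z + norm (\<zeta> *s v)"
    by (metis dist_norm dist_triangle add_diff_cancel_left' dist_commute)
  also have "norm (\<zeta> *s v) \<le> \<rho> * norm v"
    using assms by (simp add: norm_vector_scalar_mult mult_right_mono)
  finally show ?thesis using assms by simp
qed

lemma circle_radius_exists:
  assumes "r > 0"
  obtains \<rho> where "\<rho> > 0" "\<rho> * norm v < r"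
proof
  have *: "norm v + 1 > 0" using norm_ge_zero[of v] by linarith
  show "r / (norm v + 1) > 0" using assms * by simp
  show "r / (norm v + 1) * norm v < r" using assms * by (simp add: field_simps)
qed

lemma continuous_on_circle_translate:
  assumes "continuous_on S f" "\<And>z t. z \<in> U \<Longrightarrow> z + circlepath 0 \<rho> t *s v \<in> S"
  shows "continuous_on (U \<times> cbox 0 1) (\<lambda>(z, t). f (z + circlepath 0 \<rho> t *s (v :: complex^'n::finite)))"
proof -
  have "continuous_on (U \<times> cbox 0 1) (\<lambda>p. fst p + circlepath 0 \<rho> (snd p) *s v)"
    unfolding circlepath
    by (intro continuous_intros bounded_linear.continuous_on[OF bounded_linear_vector_scalar_mult])
  then have "continuous_on (U \<times> cbox 0 1) (\<lambda>p. f (fst p + circlepath 0 \<rho> (snd p) *s v))"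
    by (rule continuous_on_compose2[OF assms(1)]) (use assms(2) in auto)
  then show ?thesis by (simp add: case_prod_unfold)
qed

lemma continuous_on_circlepath_snd:
  "continuous_on (U \<times> cbox 0 1) (\<lambda>(z, t). circlepath 0 \<rho> t)"
  unfolding case_prod_unfold circlepath by (intro continuous_intros)

text \<open>The Cauchy integral depends continuously on the centre because \<open>g\<close> itself is continuous. Hence complex
differentiability implies \<open>C\<^sup>1\<close>.\<close>

lemma holomorphic_directional_derivative_continuous:
  fixes g :: "complex^'n::finite \<Rightarrow> complex"
  assumes S: "open S" and g: "holomorphic_fun_on S g"
  shows "continuous_on S (\<lambda>z. frechet_derivative g (at z) v)"
proof (rule continuous_at_imp_continuous_on, rule ballI)
  fix z0 assume "z0 \<in> S"
  then obtain e where e: "e > 0" "ball z0 e \<subseteq> S" using S open_contains_ball by blast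
  define r where "r = e / 2"
  have r: "r > 0" "ball z0 (2 * r) \<subseteq> S" using e by (auto simp: r_def)
  obtain \<rho> where \<rho>: "\<rho> > 0" "\<rho> * norm v < r" using circle_radius_exists[OF r(1)] .
  have in_S: "z + \<zeta> *s v \<in> S" if "z \<in> ball z0 r" "norm \<zeta> \<le> \<rho>" for z \<zeta>
    using circle_translates_in_ball[of \<rho> v r z z0 \<zeta>] \<rho> r that by auto
  have "continuous_on (ball z0 r \<times> cbox 0 1)
      (\<lambda>p. (case p of (z, t) \<Rightarrow> g (z + circlepath 0 \<rho> t *s v)) / (case p of (z, t) \<Rightarrow> circlepath 0 \<rho> t))"
    by (intro continuous_on_divide continuous_on_circle_translate[OF holomorphic_fun_on_continuous[OF g]]
        continuous_on_circlepath_snd in_S)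
       (use circlepath_0_nonzero[OF \<rho>(1)] in auto)
  then have "continuous_on (ball z0 r \<times> cbox 0 1)
      (\<lambda>(z, t). g (z + circlepath 0 \<rho> t *s v) / circlepath 0 \<rho> t)"
    by (simp add: case_prod_unfold)
  from integral_continuous_on_param[OF this]
  have "continuous_on (ball z0 r) (\<lambda>z. frechet_derivative g (at z) v)"
    by (rule continuous_on_eq)
       (use holomorphic_directional_derivative_integral[OF g \<rho>(1) in_S] in auto)
  then show "isCont (\<lambda>z. frechet_derivative g (at z) v) z0"
    using r(1) by (simp add: continuous_on_eq_continuous_at)
qed

text \<open>Since \<open>g\<close> is \<open>C\<^sup>1\<close>, the Cauchy integral for the directional derivative may be differentiated under
the integral sign; the result is an average of the complex linear derivatives of \<open>g\<close>, hence complex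
linear. Induction then yields derivatives of all orders.\<close>

lemma holomorphic_fun_on_directional_derivative:
  fixes g :: "complex^'n::finite \<Rightarrow> complex"
  assumes S: "open S" and g: "holomorphic_fun_on S g"
  shows "holomorphic_fun_on S (\<lambda>z. frechet_derivative g (at z) v)"
  unfolding holomorphic_fun_on_def
proof
  fix z0 assume "z0 \<in> S"
  then obtain e where e: "e > 0" "ball z0 e \<subseteq> S" using S open_contains_ball by blast
  define r where "r = e / 2"
  have r: "r > 0" "ball z0 (2 * r) \<subseteq> S" using e by (auto simp: r_def)
  obtain \<rho> where \<rho>: "\<rho> > 0" "\<rho> * norm v < r" using circle_radius_exists[OF r(1)] .
  have in_S: "z + \<zeta> *s v \<in> S" if "z \<in> ball z0 r" "norm \<zeta> \<le> \<rho>" for z \<zeta>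
    using circle_translates_in_ball[of \<rho> v r z z0 \<zeta>] \<rho> r that by auto
  have in_S': "z + circlepath 0 \<rho> t *s v \<in> S" if "z \<in> ball z0 r" for z t
    using in_S[OF that] circlepath_0_nonzero[OF \<rho>(1)] by simp
  define D where "D z = frechet_derivative g (at z)" for z
  define c where "c t = circlepath 0 \<rho> t" for t
  have c: "c t \<noteq> 0" for t unfolding c_def using circlepath_0_nonzero[OF \<rho>(1)] by simp
  note in_S' = in_S'[folded c_def]
  have bl: "bounded_linear (\<lambda>w. D (z + c t *s v) w / c t)" if "z \<in> ball z0 r" for z t
    unfolding D_def divide_inverse
    using holomorphic_fun_onD(1)[OF g in_S'[OF that]] has_derivative_bounded_linear
    by (intro bounded_linear_mult_const) blast
  define G where "G z t = Blinfun (\<lambda>w. D (z + c t *s v) w / c t)" for z t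
  have G: "blinfun_apply (G z t) = (\<lambda>w. D (z + c t *s v) w / c t)" if "z \<in> ball z0 r" for z t
    unfolding G_def by (rule bounded_linear_Blinfun_apply[OF bl[OF that]])
  have cont_quot: "continuous_on (ball z0 r \<times> cbox 0 1) (\<lambda>(z, t). f (z + c t *s v) / c t)"
    if "continuous_on S f" for f :: "complex^'n \<Rightarrow> complex"
  proof -
    have "continuous_on (ball z0 r \<times> cbox 0 1)
        (\<lambda>p. (case p of (z, t) \<Rightarrow> f (z + circlepath 0 \<rho> t *s v)) / (case p of (z, t) \<Rightarrow> circlepath 0 \<rho> t))"
      by (intro continuous_on_divide continuous_on_circle_translate[OF that]
          continuous_on_circlepath_snd in_S'[unfolded c_def])
         (use circlepath_0_nonzero[OF \<rho>(1)] in auto)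
    then show ?thesis by (simp add: case_prod_unfold c_def)
  qed
  have contG: "continuous_on (ball z0 r \<times> cbox 0 1) (\<lambda>(z, t). G z t)"
  proof (rule continuous_on_blinfun_componentwise)
    fix w :: "complex^'n"
    show "continuous_on (ball z0 r \<times> cbox 0 1) (\<lambda>p. blinfun_apply (case p of (z, t) \<Rightarrow> G z t) w)"
      by (rule continuous_on_eq[OF cont_quot[OF
            holomorphic_directional_derivative_continuous[OF S g, of w]]])
         (auto simp: G D_def)
  qed
  have deriv: "((\<lambda>z. g (z + c t *s v) / c t) has_derivative blinfun_apply (G z t)) (at z within ball z0 r)"
    if "z \<in> ball z0 r" for z t
  proof -
    have "((\<lambda>z. z + c t *s v) has_derivative (\<lambda>w. w)) (at z within ball z0 r)"
      by (auto intro!: derivative_eq_intros)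
    from has_derivative_compose[OF this holomorphic_fun_onD(1)[OF g in_S'[OF that]]]
    have "((\<lambda>z. g (z + c t *s v)) has_derivative D (z + c t *s v)) (at z within ball z0 r)"
      by (simp add: D_def)
    from bounded_linear.has_derivative[OF bounded_linear_divide[of "c t"] this]
    show ?thesis unfolding G[OF that] .
  qed
  have slice: "continuous_on (cbox 0 1) (F z)"
    if "continuous_on (ball z0 r \<times> cbox 0 1) (\<lambda>(z, t). F z t)" "z \<in> ball z0 r"
    for F :: "complex^'n \<Rightarrow> real \<Rightarrow> 'b::real_normed_vector" and z
  proof -
    have "continuous_on (cbox 0 1) (\<lambda>t. (z, t))" by (intro continuous_intros)
    from continuous_on_compose2[OF that(1) this] show ?thesis using that(2) by (simp add: image_subset_iff)
  qed
  have "((\<lambda>z. integral (cbox 0 1) (\<lambda>t. g (z + c t *s v) / c t)) has_derivative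
      blinfun_apply (integral (cbox 0 1) (G z0))) (at z0 within ball z0 r)"
    by (rule leibniz_rule[OF deriv integrable_continuous[OF
            slice[OF cont_quot[OF holomorphic_fun_on_continuous[OF g]]]] contG])
       (use r in auto)
  then have "((\<lambda>z. integral (cbox 0 1) (\<lambda>t. g (z + c t *s v) / c t)) has_derivative
      blinfun_apply (integral (cbox 0 1) (G z0))) (at z0)"
    using r by (simp add: at_within_open[OF _ open_ball])
  from has_derivative_transform_within_open[OF this open_ball[of z0 r]]
  have "((\<lambda>z. frechet_derivative g (at z) v) has_derivative
      blinfun_apply (integral (cbox 0 1) (G z0))) (at z0)"
    using r holomorphic_directional_derivative_integral[OF g \<rho>(1) in_S] by (simp add: c_def)
  moreover have "blinfun_apply (integral (cbox 0 1) (G z0)) (a *s w) =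
      a * blinfun_apply (integral (cbox 0 1) (G z0)) w" for a w
  proof -
    have z0: "z0 \<in> ball z0 r" using r by simp
    have "G z0 integrable_on cbox 0 1"
      using slice[OF contG z0] by (rule integrable_continuous)
    then have "blinfun_apply (integral (cbox 0 1) (G z0)) w =
        integral (cbox 0 1) (\<lambda>t. D (z0 + c t *s v) w / c t)" for w
      by (simp add: blinfun_apply_integral G[OF z0])
    then show ?thesis
      using holomorphic_fun_onD(2)[OF g in_S'[OF z0]]
      by (simp add: D_def integral_mult_right flip: times_divide_eq_right)
  qed
  ultimately show "\<exists>L. ((\<lambda>z. frechet_derivative g (at z) v) has_derivative L) (at z0) \<and>
      (\<forall>c v. L (c *s v) = c * L v)" by blast
qed

lemma holomorphic_fun_on_Ck:
  assumes "open S" "holomorphic_fun_on S g"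
  shows "Ck_on k S g"
  using assms(2)
proof (induction k arbitrary: g)
  case 0
  then show ?case using holomorphic_fun_on_continuous by simp
next
  case (Suc k)
  show ?case
    by (rule Ck_on_SucI[OF assms(1) holomorphic_fun_onD(1)[OF Suc.prems]
          Suc.IH[OF holomorphic_fun_on_directional_derivative[OF assms(1) Suc.prems]]])
qed

lemma holo_map_on_component:
  assumes "holo_map_on S f"
  shows "holomorphic_fun_on S (\<lambda>z. f z $ i)"
  unfolding holomorphic_fun_on_def
proof
  fix z assume "z \<in> S"
  then obtain L where L: "(f has_derivative L) (at z)" "\<forall>c v. L (c *s v) = c *s L v"
    using assms unfolding holo_map_on_def by blast
  show "\<exists>L. ((\<lambda>z. f z $ i) has_derivative L) (at z) \<and> (\<forall>c v. L (c *s v) = c * L v)"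
    by (rule exI[of _ "\<lambda>v. L v $ i"])
       (use bounded_linear.has_derivative[OF bounded_linear_vec_nth L(1)] L(2) in simp)
qed

lemma holo_map_on_Cinf:
  assumes "open S" "holo_map_on S f"
  shows "Cinf_on S f"
  unfolding Cinf_on_def
  by (intro allI Ck_on_vec holomorphic_fun_on_Ck assms holo_map_on_component)

section \<open>Wirtinger derivatives\<close>

lemma wirtinger_bar_cnj:
  assumes "f differentiable (at z)"
  shows "wirtinger_bar j f z = cnj (wirtinger j (\<lambda>y. cnj (f y)) z)"
  by (simp add: wirtinger_bar_def wirtinger_def
      frechet_derivative_bounded_linear[OF bounded_linear_cnj assms])

lemma wirtinger_cong_open:
  assumes "open S" "z \<in> S" "\<And>y. y \<in> S \<Longrightarrow> f y = g y"
  shows "wirtinger j f z = wirtinger j g z" "wirtinger_bar j f z = wirtinger_bar j g z"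
  using frechet_derivative_cong_open[OF assms] by (simp_all add: wirtinger_def wirtinger_bar_def)

lemma frechet_derivative_add:
  assumes "f differentiable (at z)" "g differentiable (at z)"
  shows "frechet_derivative (\<lambda>z. f z + g z) (at z) u =
    frechet_derivative f (at z) u + frechet_derivative g (at z) u"
  by (rule fun_cong[OF frechet_derivative_at[symmetric, OF has_derivative_add]])
     (use assms frechet_derivative_works in auto)

lemma wirtinger_add:
  assumes "f differentiable (at z)" "g differentiable (at z)"
  shows "wirtinger j (\<lambda>z. f z + g z) z = wirtinger j f z + wirtinger j g z"
  by (simp add: wirtinger_def frechet_derivative_add[OF assms] algebra_simps diff_divide_distrib
      add_divide_distrib)

lemma frechet_derivative_sum_mult:
  fixes f g :: "'i \<Rightarrow> 'a::real_normed_vector \<Rightarrow> complex"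
  assumes "\<And>i. i \<in> I \<Longrightarrow> f i differentiable (at z)" "\<And>i. i \<in> I \<Longrightarrow> g i differentiable (at z)"
  shows "frechet_derivative (\<lambda>z. \<Sum>i\<in>I. f i z * g i z) (at z) u =
    (\<Sum>i\<in>I. f i z * frechet_derivative (g i) (at z) u + frechet_derivative (f i) (at z) u * g i z)"
  by (rule fun_cong[OF frechet_derivative_at[symmetric, OF has_derivative_sum[OF has_derivative_mult]]])
     (use assms frechet_derivative_works in auto)

lemma wirtinger_sum_mult:
  assumes "\<And>i. i \<in> I \<Longrightarrow> f i differentiable (at z)" "\<And>i. i \<in> I \<Longrightarrow> g i differentiable (at z)"
  shows "wirtinger j (\<lambda>z. \<Sum>i\<in>I. f i z * g i z) z =
      (\<Sum>i\<in>I. wirtinger j (f i) z * g i z) + (\<Sum>i\<in>I. f i z * wirtinger j (g i) z)"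
    and "wirtinger_bar j (\<lambda>z. \<Sum>i\<in>I. f i z * g i z) z =
      (\<Sum>i\<in>I. wirtinger_bar j (f i) z * g i z) + (\<Sum>i\<in>I. f i z * wirtinger_bar j (g i) z)"
proof -
  have D: "frechet_derivative (\<lambda>z. \<Sum>i\<in>I. f i z * g i z) (at z) u =
      (\<Sum>i\<in>I. frechet_derivative (f i) (at z) u * g i z) +
      (\<Sum>i\<in>I. f i z * frechet_derivative (g i) (at z) u)" for u
    by (simp add: frechet_derivative_sum_mult[of I f z g, OF assms] sum.distrib)
  show "wirtinger j (\<lambda>z. \<Sum>i\<in>I. f i z * g i z) z =
      (\<Sum>i\<in>I. wirtinger j (f i) z * g i z) + (\<Sum>i\<in>I. f i z * wirtinger j (g i) z)"
    unfolding wirtinger_def D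
    by (simp add: sum_distrib_left sum_subtractf sum_divide_distrib algebra_simps
        diff_divide_distrib add_divide_distrib)
  show "wirtinger_bar j (\<lambda>z. \<Sum>i\<in>I. f i z * g i z) z =
      (\<Sum>i\<in>I. wirtinger_bar j (f i) z * g i z) + (\<Sum>i\<in>I. f i z * wirtinger_bar j (g i) z)"
    unfolding wirtinger_bar_def D
    by (simp add: sum_distrib_left sum.distrib sum_divide_distrib algebra_simps
        diff_divide_distrib add_divide_distrib)
qed

text \<open>Differentiating the operator \<open>wirtinger j\<close> applied to \<open>f\<close> in a direction \<open>u\<close> amounts to applying it
to the derivative of \<open>f\<close> along \<open>u\<close>, by symmetry of second derivatives. Taking \<open>u\<close> to be the coordinate
directions makes any two Wirtinger operators commute.\<close>

lemma frechet_derivative_wirtinger: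
  assumes S: "open S" "z \<in> S" and C2: "Ck_on 2 S f"
  shows "frechet_derivative (wirtinger j f) (at z) u =
      (frechet_derivative (\<lambda>y. frechet_derivative f (at y) u) (at z) (axis j 1) -
       \<i> * frechet_derivative (\<lambda>y. frechet_derivative f (at y) u) (at z) (axis j \<i>)) / 2"
    and "frechet_derivative (wirtinger_bar j f) (at z) u =
      (frechet_derivative (\<lambda>y. frechet_derivative f (at y) u) (at z) (axis j 1) +
       \<i> * frechet_derivative (\<lambda>y. frechet_derivative f (at y) u) (at z) (axis j \<i>)) / 2"
proof -
  define D where "D w y = frechet_derivative f (at y) w" for w y
  have "D w differentiable (at z)" for w
    using C2 S unfolding D_def[abs_def] by (simp add: numeral_2_eq_2)
  then have D: "(D w has_derivative frechet_derivative (D w) (at z)) (at z)" for w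
    by (simp add: frechet_derivative_works)
  have symm: "frechet_derivative (D w) (at z) u = frechet_derivative (D u) (at z) w" for w
    using second_derivative_symmetric[OF S C2] unfolding D_def[abs_def] .
  have w: "wirtinger j f = (\<lambda>y. (D (axis j 1) y - \<i> * D (axis j \<i>) y) / 2)"
    "wirtinger_bar j f = (\<lambda>y. (D (axis j 1) y + \<i> * D (axis j \<i>) y) / 2)"
    by (simp_all add: wirtinger_def wirtinger_bar_def D_def fun_eq_iff)
  have "(wirtinger j f has_derivative (\<lambda>v. (frechet_derivative (D (axis j 1)) (at z) v -
      \<i> * frechet_derivative (D (axis j \<i>)) (at z) v) / 2)) (at z)"
    unfolding w by (intro bounded_linear.has_derivative[OF bounded_linear_divide]
        has_derivative_diff bounded_linear.has_derivative[OF bounded_linear_mult_right] D)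
  note D1 = fun_cong[OF frechet_derivative_at[OF this, symmetric], of u]
  show "frechet_derivative (wirtinger j f) (at z) u =
      (frechet_derivative (\<lambda>y. frechet_derivative f (at y) u) (at z) (axis j 1) -
       \<i> * frechet_derivative (\<lambda>y. frechet_derivative f (at y) u) (at z) (axis j \<i>)) / 2"
    unfolding D1 symm by (simp only: D_def[abs_def])
  have "(wirtinger_bar j f has_derivative (\<lambda>v. (frechet_derivative (D (axis j 1)) (at z) v +
      \<i> * frechet_derivative (D (axis j \<i>)) (at z) v) / 2)) (at z)"
    unfolding w by (intro bounded_linear.has_derivative[OF bounded_linear_divide]
        has_derivative_add bounded_linear.has_derivative[OF bounded_linear_mult_right] D)
  note D2 = fun_cong[OF frechet_derivative_at[OF this, symmetric], of u]
  show "frechet_derivative (wirtinger_bar j f) (at z) u =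
      (frechet_derivative (\<lambda>y. frechet_derivative f (at y) u) (at z) (axis j 1) +
       \<i> * frechet_derivative (\<lambda>y. frechet_derivative f (at y) u) (at z) (axis j \<i>)) / 2"
    unfolding D2 symm by (simp only: D_def[abs_def])
qed

lemma Ck_on_wirtinger:
  assumes "open S" "Ck_on (Suc k) S f"
  shows "Ck_on k S (wirtinger j f)" "Ck_on k S (wirtinger_bar j f)"
proof -
  have D: "Ck_on k S (\<lambda>z. frechet_derivative f (at z) u)" for u using assms(2) by simp
  have "Ck_on k S (\<lambda>z. (frechet_derivative f (at z) (axis j 1) +
      c * frechet_derivative f (at z) (axis j \<i>)) / 2)" for c
    by (rule Ck_on_bounded_linear[OF assms(1) bounded_linear_divide], rule Ck_on_add[OF assms(1) D],
        rule Ck_on_bounded_linear[OF assms(1) bounded_linear_mult_right D])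
  from this[of "- \<i>"] this[of \<i>]
  show "Ck_on k S (wirtinger j f)" "Ck_on k S (wirtinger_bar j f)"
    by (simp_all add: wirtinger_def[abs_def] wirtinger_bar_def[abs_def])
qed

lemma wirtinger_commute:
  assumes S: "open S" "z \<in> S" and C2: "Ck_on 2 S f"
  shows "wirtinger k (wirtinger_bar j f) z = wirtinger_bar j (wirtinger k f) z"
proof -
  define H where "H u w = frechet_derivative (\<lambda>y. frechet_derivative f (at y) u) (at z) w" for u w
  have sym: "H u w = H w u" for u w
    unfolding H_def by (rule second_derivative_symmetric[OF S C2])
  show ?thesis
    unfolding wirtinger_def[of k "wirtinger_bar j f"] wirtinger_bar_def[of j "wirtinger k f"]
      frechet_derivative_wirtinger[OF assms] H_def[symmetric]
    using sym[of "axis j 1" "axis k 1"] sym[of "axis j 1" "axis k \<i>"]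
      sym[of "axis j \<i>" "axis k 1"] sym[of "axis j \<i>" "axis k \<i>"]
    by (simp add: field_simps)
qed

text \<open>For a real linear \<open>D\<close>, the map \<open>w \<mapsto> (D w - \<i> D (\<i> w)) / 2\<close> is its complex linear part, with values
\<open>\<partial>f/\<partial>z\<^sub>k\<close> on the basis vectors. A complex linear change of coordinates thus produces no
derivatives in the conjugate directions.\<close>

lemma wirtinger_compose:
  fixes f :: "complex^'m::finite \<Rightarrow> complex" and \<tau> :: "complex^'n::finite \<Rightarrow> complex^'m"
  assumes \<tau>: "(\<tau> has_derivative L) (at z)" "\<And>c v. L (c *s v) = c *s L v"
    and f: "f differentiable (at (\<tau> z))"
  shows "wirtinger j (\<lambda>z. f (\<tau> z)) z = (\<Sum>k\<in>UNIV. L (axis j 1) $ k * wirtinger k f (\<tau> z))"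
proof -
  define D where "D = frechet_derivative f (at (\<tau> z))"
  have D: "(f has_derivative D) (at (\<tau> z))" using f by (simp add: D_def frechet_derivative_works)
  then have linD: "linear D" by (rule has_derivative_linear)
  have comp: "frechet_derivative (\<lambda>z. f (\<tau> z)) (at z) u = D (L u)" for u
    by (rule fun_cong[OF frechet_derivative_at[symmetric, OF has_derivative_compose[OF \<tau>(1) D]]])
  have ax: "axis j \<i> = \<i> *s (axis j 1 :: complex^'n)"
    by (simp add: vec_eq_iff axis_def)
  \<comment> \<open>Both sides are complex linear in \<open>w\<close>; the real basis \<open>axis k 1\<close>, \<open>axis k \<i>\<close> is used.\<close>
  have split: "(D w - \<i> * D (\<i> *s w)) / 2 = (\<Sum>k\<in>UNIV. w $ k * wirtinger k f (\<tau> z))" for w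
  proof -
    have w: "w = (\<Sum>k\<in>UNIV. Re (w $ k) *\<^sub>R axis k 1 + Im (w $ k) *\<^sub>R axis k \<i>)"
      by (simp add: vec_eq_iff axis_def if_distrib sum.distrib sum.delta' complex_eq_iff cong: if_cong)
    have iw: "\<i> *s w = (\<Sum>k\<in>UNIV. Re (w $ k) *\<^sub>R axis k \<i> - Im (w $ k) *\<^sub>R axis k 1)"
      by (simp add: vec_eq_iff axis_def if_distrib sum.distrib sum_subtractf sum.delta' complex_eq_iff
          cong: if_cong)
    have "D w = (\<Sum>k\<in>UNIV. Re (w $ k) *\<^sub>R D (axis k 1) + Im (w $ k) *\<^sub>R D (axis k \<i>))"
      by (subst w) (simp add: linear_sum[OF linD] linear_add[OF linD] linear_cmul[OF linD])
    moreover have "D (\<i> *s w) = (\<Sum>k\<in>UNIV. Re (w $ k) *\<^sub>R D (axis k \<i>) - Im (w $ k) *\<^sub>R D (axis k 1))"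
      by (subst iw) (simp add: linear_sum[OF linD] linear_diff[OF linD] linear_cmul[OF linD])
    ultimately have "(D w - \<i> * D (\<i> *s w)) / 2 =
      (\<Sum>k\<in>UNIV. ((Re (w $ k) *\<^sub>R D (axis k 1) + Im (w $ k) *\<^sub>R D (axis k \<i>)) -
         \<i> * (Re (w $ k) *\<^sub>R D (axis k \<i>) - Im (w $ k) *\<^sub>R D (axis k 1))) / 2)"
      by (simp only: sum_distrib_left sum_subtractf[symmetric] sum_divide_distrib)
    also have "\<dots> = (\<Sum>k\<in>UNIV. w $ k * wirtinger k f (\<tau> z))"
      unfolding wirtinger_def D_def[symmetric]
      by (intro sum.cong refl) (simp add: complex_eq_iff field_simps)
    finally show ?thesis .
  qed
  show ?thesis
    unfolding wirtinger_def[of j] comp ax \<tau>(2) split ..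
qed

section \<open>Smooth functions on a complex manifold\<close>

locale complex_mfd =
  fixes A :: "('x::topological_space, 'n::finite) chart set"
  assumes mfd: "complex_manifold A"
begin

lemma chart_open: "(U, \<phi>) \<in> A \<Longrightarrow> open U"
  using mfd unfolding complex_manifold_def by blast

lemma chart_at:
  obtains U \<phi> where "(U, \<phi>) \<in> A" "x \<in> U"
  using mfd unfolding complex_manifold_def by blast

lemma chart_inj:
  assumes "(U, \<phi>) \<in> A" "y \<in> U"
  shows "inv_into U \<phi> (\<phi> y) = y"
proof -
  have "homeomorphism U (\<phi> ` U) \<phi> (inv_into U \<phi>)"
    using mfd assms unfolding complex_manifold_def by blast
  then show ?thesis using assms by (simp add: homeomorphism_def)
qed

lemma chart_image_open:
  assumes c: "(U, \<phi>) \<in> A" and W: "open W"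
  shows "open (\<phi> ` (U \<inter> W))"
proof -
  have h: "homeomorphism U (\<phi> ` U) \<phi> (inv_into U \<phi>)" and o: "open (\<phi> ` U)"
    using mfd c unfolding complex_manifold_def by blast+
  have "openin (top_of_set (\<phi> ` U)) (\<phi> ` (U \<inter> W))"
    by (rule homeomorphism_imp_open_map[OF h]) (use W in \<open>auto simp: openin_open\<close>)
  then show ?thesis using o by (rule openin_open_trans)
qed

lemma smooth_on_iff:
  "smooth_on A W f \<longleftrightarrow> (\<forall>(U, \<phi>)\<in>A. \<forall>k. Ck_on k (\<phi> ` (U \<inter> W)) (\<lambda>z. f (inv_into U \<phi> z)))"
  unfolding smooth_on_def Cinf_on_def comp_def by auto

lemma smooth_onI:
  assumes "\<And>U \<phi> k. (U, \<phi>) \<in> A \<Longrightarrow> Ck_on k (\<phi> ` (U \<inter> W)) (\<lambda>z. f (inv_into U \<phi> z))"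
  shows "smooth_on A W f"
  using assms unfolding smooth_on_iff by auto

lemma smooth_onD:
  assumes "smooth_on A W f" "(U, \<phi>) \<in> A"
  shows "Ck_on k (\<phi> ` (U \<inter> W)) (\<lambda>z. f (inv_into U \<phi> z))"
  using assms unfolding smooth_on_iff by auto

lemma smooth_on_cong:
  assumes "open W" "\<And>y. y \<in> W \<Longrightarrow> f y = g y" "smooth_on A W f"
  shows "smooth_on A W g"
proof (rule smooth_onI)
  fix U \<phi> k assume c: "(U, \<phi>) \<in> A"
  show "Ck_on k (\<phi> ` (U \<inter> W)) (\<lambda>z. g (inv_into U \<phi> z))"
    by (rule Ck_on_cong[OF chart_image_open[OF c assms(1)] _ smooth_onD[OF assms(3) c]])
       (use assms(2) chart_inj[OF c] in auto)
qed

lemma smooth_on_subset: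
  assumes "smooth_on A W f" "V \<subseteq> W"
  shows "smooth_on A V f"
  by (rule smooth_onI, rule Ck_on_subset[OF smooth_onD[OF assms(1)]]) (use assms(2) in auto)

lemma smooth_on_const: "smooth_on A W (\<lambda>x. c)"
  by (rule smooth_onI) (rule Ck_on_const)

lemma smooth_on_bounded_linear:
  assumes "open W" "bounded_linear B" "smooth_on A W f"
  shows "smooth_on A W (\<lambda>x. B (f x))"
  by (rule smooth_onI, rule Ck_on_bounded_linear[OF chart_image_open assms(2) smooth_onD[OF assms(3)]])
     (use assms(1) in auto)

lemmas smooth_on_cnj = smooth_on_bounded_linear[OF _ bounded_linear_cnj]
lemmas smooth_on_vec_nth = smooth_on_bounded_linear[OF _ bounded_linear_vec_nth]

lemma smooth_on_add:
  assumes "open W" "smooth_on A W f" "smooth_on A W g"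
  shows "smooth_on A W (\<lambda>x. f x + g x)"
  by (rule smooth_onI, rule Ck_on_add[OF chart_image_open smooth_onD[OF assms(2)] smooth_onD[OF assms(3)]])
     (use assms(1) in auto)

lemma smooth_on_mult:
  fixes f g :: "'x \<Rightarrow> complex"
  assumes "open W" "smooth_on A W f" "smooth_on A W g"
  shows "smooth_on A W (\<lambda>x. f x * g x)"
  by (rule smooth_onI, rule Ck_on_mult[OF chart_image_open smooth_onD[OF assms(2)] smooth_onD[OF assms(3)]])
     (use assms(1) in auto)

lemma smooth_on_inverse:
  fixes f :: "'x \<Rightarrow> complex"
  assumes "open W" "smooth_on A W f" "\<And>x. x \<in> W \<Longrightarrow> f x \<noteq> 0"
  shows "smooth_on A W (\<lambda>x. inverse (f x))"
proof (rule smooth_onI)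
  fix U \<phi> k assume c: "(U, \<phi>) \<in> A"
  show "Ck_on k (\<phi> ` (U \<inter> W)) (\<lambda>z. inverse (f (inv_into U \<phi> z)))"
    by (rule Ck_on_inverse[OF chart_image_open[OF c assms(1)] smooth_onD[OF assms(2) c]])
       (use assms(3) chart_inj[OF c] in auto)
qed

lemma smooth_on_sum:
  assumes "open W" "\<And>i. i \<in> I \<Longrightarrow> smooth_on A W (f i)"
  shows "smooth_on A W (\<lambda>x. \<Sum>i\<in>I. f i x)"
  by (rule smooth_onI, rule Ck_on_sum[OF chart_image_open smooth_onD[OF assms(2)]])
     (use assms(1) in auto)

lemma smooth_on_prod:
  fixes f :: "'i \<Rightarrow> 'x \<Rightarrow> complex"
  assumes "open W" "\<And>i. i \<in> I \<Longrightarrow> smooth_on A W (f i)"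
  shows "smooth_on A W (\<lambda>x. \<Prod>i\<in>I. f i x)"
  by (rule smooth_onI, rule Ck_on_prod[OF chart_image_open smooth_onD[OF assms(2)]])
     (use assms(1) in auto)

lemma smooth_on_vec:
  fixes f :: "'x \<Rightarrow> complex^'m::finite"
  assumes "open W" "\<And>i. smooth_on A W (\<lambda>x. f x $ i)"
  shows "smooth_on A W f"
  by (rule smooth_onI, rule Ck_on_vec[OF chart_image_open smooth_onD[OF assms(2)]])
     (use assms(1) in auto)

lemma smooth_on_det:
  fixes M :: "'x \<Rightarrow> complex^'m^'m::finite"
  assumes "open W" "\<And>i j. smooth_on A W (\<lambda>x. M x $ i $ j)"
  shows "smooth_on A W (\<lambda>x. det (M x))"
  unfolding det_def
  by (intro smooth_on_sum[OF assms(1)] smooth_on_mult[OF assms(1)] smooth_on_prod[OF assms(1)]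
      smooth_on_const assms(2))

lemma holomorphic_map_on_smooth:
  assumes "open W" "holomorphic_map_on A W f"
  shows "smooth_on A W f"
  unfolding smooth_on_def
proof clarify
  fix U \<phi> assume c: "(U, \<phi>) \<in> A"
  show "Cinf_on (\<phi> ` (U \<inter> W)) (f \<circ> inv_into U \<phi>)"
    by (rule holo_map_on_Cinf[OF chart_image_open[OF c assms(1)]])
       (use assms(2) c in \<open>auto simp: holomorphic_map_on_def\<close>)
qed

lemma chart_transition:
  assumes "(U, \<phi>) \<in> A" "(V, \<tau>) \<in> A"
  shows "holo_map_on (\<phi> ` (U \<inter> V)) (\<tau> \<circ> inv_into U \<phi>)"
  using mfd assms unfolding complex_manifold_def by blast

lemma smooth_on_coordinate:
  assumes "(V, \<tau>) \<in> A"
  shows "smooth_on A V (\<lambda>y. \<tau> y $ j)"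
proof (rule smooth_on_vec_nth[OF chart_open[OF assms]])
  show "smooth_on A V \<tau>"
    by (rule holomorphic_map_on_smooth[OF chart_open[OF assms]])
       (use chart_transition[OF _ assms] in \<open>auto simp: holomorphic_map_on_def\<close>)
qed

section \<open>Germs of smooth functions\<close>

lemma smooth_nearI: "open W \<Longrightarrow> x \<in> W \<Longrightarrow> smooth_on A W f \<Longrightarrow> smooth_near A x f"
  unfolding smooth_near_def by blast

lemma smooth_near_cong:
  fixes f g :: "'x \<Rightarrow> complex"
  assumes "open V" "x \<in> V" "\<And>y. y \<in> V \<Longrightarrow> f y = g y"
  shows "smooth_near A x f \<longleftrightarrow> smooth_near A x g"
proof -
  have "smooth_near A x g" if fg: "\<And>y. y \<in> V \<Longrightarrow> f y = g y" and sm: "smooth_near A x f"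
    for f g :: "'x \<Rightarrow> complex"
  proof -
    obtain W where W: "open W" "x \<in> W" "smooth_on A W f"
      using sm unfolding smooth_near_def by blast
    have "smooth_on A (W \<inter> V) g"
      by (rule smooth_on_cong[OF _ _ smooth_on_subset[OF W(3)]]) (use W fg assms(1) in auto)
    then show ?thesis using W assms(1,2) by (intro smooth_nearI[of "W \<inter> V"]) auto
  qed
  from this[of f g] this[of g f] assms(3) show ?thesis by metis
qed

lemma smooth_near_cnj: "smooth_near A x (\<lambda>y. cnj (f y)) \<longleftrightarrow> smooth_near A x f"
  using smooth_on_cnj[of _ f] smooth_on_cnj[of _ "\<lambda>y. cnj (f y)"]
  unfolding smooth_near_def by auto

lemma smooth_near_chart:
  assumes "smooth_near A x f" "(U, \<phi>) \<in> A" "x \<in> U"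
  shows "(f \<circ> inv_into U \<phi>) differentiable (at (\<phi> x))"
proof -
  obtain W where W: "open W" "x \<in> W" "smooth_on A W f"
    using assms(1) unfolding smooth_near_def by blast
  have "Ck_on (Suc 0) (\<phi> ` (U \<inter> W)) (\<lambda>z. f (inv_into U \<phi> z))"
    by (rule smooth_onD[OF W(3) assms(2)])
  then show ?thesis using assms(3) W(2) by (auto simp: comp_def)
qed

lemma chart_germ_cong:
  assumes c: "(U, \<phi>) \<in> A" "x \<in> U" and V: "open V" "x \<in> V" "\<And>y. y \<in> V \<Longrightarrow> f y = g y"
  shows "frechet_derivative (f \<circ> inv_into U \<phi>) (at (\<phi> x)) = frechet_derivative (g \<circ> inv_into U \<phi>) (at (\<phi> x))"
  by (rule frechet_derivative_cong_open[OF chart_image_open[OF c(1) V(1)]])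
     (use c V chart_inj[OF c(1)] in auto)


section \<open>Complex tangent vectors\<close>

lemma coord_dz_cong:
  assumes "c \<in> A" "x \<in> fst c" "open V" "x \<in> V" "\<And>y. y \<in> V \<Longrightarrow> f y = g y"
  shows "coord_dz A c j x f = coord_dz A c j x g" "coord_dzbar A c j x f = coord_dzbar A c j x g"
  using chart_germ_cong[of "fst c" "snd c" x V f g] smooth_near_cong[of V x f g] assms
  by (simp_all add: coord_dz_def coord_dzbar_def wirtinger_def wirtinger_bar_def)

lemma smooth_near_add:
  fixes f g :: "'x \<Rightarrow> complex"
  assumes "smooth_near A x f" "smooth_near A x g"
  shows "smooth_near A x (\<lambda>y. f y + g y)"
proof -
  obtain V W where V: "open V" "x \<in> V" "smooth_on A V f" and W: "open W" "x \<in> W" "smooth_on A W g"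
    using assms unfolding smooth_near_def by blast
  have "smooth_on A (V \<inter> W) (\<lambda>y. f y + g y)"
    by (rule smooth_on_add[OF _ smooth_on_subset[OF V(3)] smooth_on_subset[OF W(3)]])
       (use V W in auto)
  then show ?thesis using V W by (intro smooth_nearI[of "V \<inter> W"]) auto
qed

lemma coord_dz_add:
  assumes "c \<in> A" "x \<in> fst c" "smooth_near A x f" "smooth_near A x g"
  shows "coord_dz A c j x (\<lambda>y. f y + g y) = coord_dz A c j x f + coord_dz A c j x g"
proof -
  have "wirtinger j ((\<lambda>y. f y + g y) \<circ> inv_into (fst c) (snd c)) (snd c x) =
      wirtinger j (f \<circ> inv_into (fst c) (snd c)) (snd c x) +
      wirtinger j (g \<circ> inv_into (fst c) (snd c)) (snd c x)"
    using wirtinger_add[OF smooth_near_chart[of x f "fst c" "snd c"]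
        smooth_near_chart[of x g "fst c" "snd c"], of j] assms
    by (simp add: comp_def)
  then show ?thesis
    using assms smooth_near_add[OF assms(3,4)] by (simp add: coord_dz_def)
qed

text \<open>This identity transfers statements about vectors of type (1,0) to vectors of type (0,1).\<close>

lemma coord_dzbar_cnj:
  assumes "c \<in> A" "x \<in> fst c"
  shows "coord_dzbar A c j x f = cnj (coord_dz A c j x (\<lambda>y. cnj (f y)))"
proof (cases "smooth_near A x f")
  case True
  have "(f \<circ> inv_into (fst c) (snd c)) differentiable (at (snd c x))"
    using smooth_near_chart[OF True, of "fst c" "snd c"] assms by simp
  from wirtinger_bar_cnj[OF this, of j] show ?thesis
    using True by (simp add: coord_dz_def coord_dzbar_def smooth_near_cnj comp_def)
next
  case False
  then show ?thesis by (simp add: coord_dz_def coord_dzbar_def smooth_near_cnj)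
qed

lemma conj_vec_conj_vec [simp]: "conj_vec (conj_vec v) = v"
  by (simp add: conj_vec_def fun_eq_iff)

lemma conj_vec_T10: "v \<in> T10 A x \<Longrightarrow> conj_vec v \<in> T01 A x"
proof -
  assume "v \<in> T10 A x"
  then obtain c a where c: "c \<in> A" "x \<in> fst c" and v: "v = (\<lambda>f. \<Sum>j\<in>UNIV. a j * coord_dz A c j x f)"
    unfolding T10_def by blast
  have "conj_vec v = (\<lambda>f. \<Sum>j\<in>UNIV. cnj (a j) * coord_dzbar A c j x f)"
    by (simp add: v conj_vec_def coord_dzbar_cnj[OF c] fun_eq_iff)
  then show "conj_vec v \<in> T01 A x" unfolding T01_def using c by (auto intro!: exI bexI[of _ c])
qed

lemma conj_vec_T01: "v \<in> T01 A x \<Longrightarrow> conj_vec v \<in> T10 A x"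
proof -
  assume "v \<in> T01 A x"
  then obtain c a where c: "c \<in> A" "x \<in> fst c" and v: "v = (\<lambda>f. \<Sum>j\<in>UNIV. a j * coord_dzbar A c j x f)"
    unfolding T01_def by blast
  have "conj_vec v = (\<lambda>f. \<Sum>j\<in>UNIV. cnj (a j) * coord_dz A c j x f)"
    by (simp add: v conj_vec_def coord_dzbar_cnj[OF c] fun_eq_iff)
  then show "conj_vec v \<in> T10 A x" unfolding T10_def using c by (auto intro!: exI bexI[of _ c])
qed

lemma zero_T10: "(\<lambda>f. 0) \<in> T10 A x"
proof -
  obtain U \<phi> where "(U, \<phi>) \<in> A" "x \<in> U" using chart_at .
  then show ?thesis
    unfolding T10_def by (auto intro!: bexI[of _ "(U, \<phi>)"] exI[of _ "\<lambda>_. 0"])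
qed

lemma zero_T01: "(\<lambda>f. 0) \<in> T01 A x"
proof -
  have "(conj_vec (\<lambda>f. 0) :: 'x ctangent) = (\<lambda>f. 0)" by (simp add: conj_vec_def fun_eq_iff)
  then show ?thesis using conj_vec_T10[OF zero_T10, of x] by simp
qed

lemma T10_subset_TC: "T10 A x \<subseteq> TC A x"
proof
  fix v assume "v \<in> T10 A x"
  moreover have "v = (\<lambda>f. v f + 0)" by simp
  ultimately show "v \<in> TC A x" unfolding TC_def mem_Collect_eq using zero_T01 by (intro bexI)
qed

lemma T01_subset_TC: "T01 A x \<subseteq> TC A x"
proof
  fix v assume "v \<in> T01 A x"
  moreover have "v = (\<lambda>f. 0 + v f)" by simp
  ultimately show "v \<in> TC A x" unfolding TC_def mem_Collect_eq using zero_T10 by (intro bexI)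
qed

lemma conj_vec_TC: "v \<in> TC A x \<Longrightarrow> conj_vec v \<in> TC A x"
proof -
  assume "v \<in> TC A x"
  then obtain u w where uw: "u \<in> T10 A x" "w \<in> T01 A x" "v = (\<lambda>f. u f + w f)"
    unfolding TC_def by blast
  have "conj_vec v = (\<lambda>f. conj_vec w f + conj_vec u f)"
    by (simp add: uw(3) conj_vec_def fun_eq_iff)
  then show "conj_vec v \<in> TC A x"
    unfolding TC_def using conj_vec_T10[OF uw(1)] conj_vec_T01[OF uw(2)] by blast
qed

lemma T10_cong:
  assumes "v \<in> T10 A x" "open V" "x \<in> V" "\<And>y. y \<in> V \<Longrightarrow> f y = g y"
  shows "v f = v g"
  using assms(1) coord_dz_cong(1)[OF _ _ assms(2,3), of _ f g] assms(4)
  unfolding T10_def by auto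

lemma T10_add:
  assumes "v \<in> T10 A x" "smooth_near A x f" "smooth_near A x g"
  shows "v (\<lambda>y. f y + g y) = v f + v g"
  using assms(1) coord_dz_add[OF _ _ assms(2,3)]
  unfolding T10_def by (auto simp: algebra_simps sum.distrib)

lemma conj_vec_conj_eq:
  "w f = cnj (conj_vec w (\<lambda>y. cnj (f y)))"
  by (simp add: conj_vec_def)

lemma TC_cong:
  assumes "v \<in> TC A x" "open V" "x \<in> V" "\<And>y. y \<in> V \<Longrightarrow> f y = g y"
  shows "v f = v g"
proof -
  obtain u w where uw: "u \<in> T10 A x" "w \<in> T01 A x" "v = (\<lambda>f. u f + w f)"
    using assms(1) unfolding TC_def by blast
  have "u f = u g" using T10_cong[OF uw(1) assms(2,3)] assms(4) by blast
  moreover have "w f = w g"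
    using T10_cong[OF conj_vec_T01[OF uw(2)] assms(2,3), of "\<lambda>y. cnj (f y)" "\<lambda>y. cnj (g y)"] assms(4)
    by (simp add: conj_vec_conj_eq[of w])
  ultimately show ?thesis by (simp add: uw(3))
qed

lemma TC_add:
  assumes "v \<in> TC A x" "smooth_near A x f" "smooth_near A x g"
  shows "v (\<lambda>y. f y + g y) = v f + v g"
proof -
  obtain u w where uw: "u \<in> T10 A x" "w \<in> T01 A x" "v = (\<lambda>f. u f + w f)"
    using assms(1) unfolding TC_def by blast
  have "u (\<lambda>y. f y + g y) = u f + u g" using T10_add[OF uw(1) assms(2,3)] .
  moreover have "w (\<lambda>y. f y + g y) = w f + w g"
    using T10_add[OF conj_vec_T01[OF uw(2)], of "\<lambda>y. cnj (f y)" "\<lambda>y. cnj (g y)"] assms(2,3)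
    by (simp add: conj_vec_conj_eq[of w] smooth_near_cnj)
  ultimately show ?thesis by (simp add: uw(3))
qed

lemma coord_dz_transform:
  assumes c: "(U, \<phi>) \<in> A" "x \<in> U" and c': "(V, \<tau>) \<in> A" "x \<in> V"
  obtains J where "\<And>f. coord_dz A (V, \<tau>) j x f = (\<Sum>k\<in>UNIV. J k * coord_dz A (U, \<phi>) k x f)"
proof -
  define T where "T = \<phi> \<circ> inv_into V \<tau>"
  have "holo_map_on (\<tau> ` (V \<inter> U)) T" unfolding T_def by (rule chart_transition[OF c'(1) c(1)])
  then obtain L where L: "(T has_derivative L) (at (\<tau> x))" "\<And>c v. L (c *s v) = c *s L v"
    using c(2) c'(2) unfolding holo_map_on_def by blast
  have Tx: "T (\<tau> x) = \<phi> x" unfolding T_def using chart_inj[OF c'] by simp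
  have "coord_dz A (V, \<tau>) j x f = (\<Sum>k\<in>UNIV. L (axis j 1) $ k * coord_dz A (U, \<phi>) k x f)" for f
  proof (cases "smooth_near A x f")
    case True
    define F where "F = f \<circ> inv_into U \<phi>"
    have F: "F differentiable (at (T (\<tau> x)))"
      unfolding F_def Tx by (rule smooth_near_chart[OF True c])
    have "wirtinger j (f \<circ> inv_into V \<tau>) (\<tau> x) = wirtinger j (\<lambda>z. F (T z)) (\<tau> x)"
      by (rule wirtinger_cong_open(1)[OF chart_image_open[OF c'(1) chart_open[OF c(1)]]])
         (use c c' chart_inj[OF c(1)] chart_inj[OF c'(1)] in \<open>auto simp: F_def T_def\<close>)
    also have "\<dots> = (\<Sum>k\<in>UNIV. L (axis j 1) $ k * wirtinger k F (\<phi> x))"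
      using wirtinger_compose[OF L F] by (simp add: Tx)
    finally show ?thesis using True by (simp add: coord_dz_def F_def)
  qed (simp add: coord_dz_def)
  then show ?thesis by (rule that)
qed

text \<open>A vector of type (1,0) may be given in some chart that varies with the point. Fixing one chart is what
makes the coefficients of a field into functions.\<close>

lemma T10_in_chart:
  assumes v: "v \<in> T10 A x" and c: "(U, \<phi>) \<in> A" "x \<in> U"
  obtains a where "\<And>f. v f = (\<Sum>k\<in>UNIV. a k * coord_dz A (U, \<phi>) k x f)"
proof -
  obtain V \<tau> b where c': "(V, \<tau>) \<in> A" "x \<in> V" and b: "v = (\<lambda>f. \<Sum>j\<in>UNIV. b j * coord_dz A (V, \<tau>) j x f)"
    using v unfolding T10_def by auto
  have "\<forall>j. \<exists>J. \<forall>f. coord_dz A (V, \<tau>) j x f = (\<Sum>k\<in>UNIV. J k * coord_dz A (U, \<phi>) k x f)"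
    using coord_dz_transform[OF c c'] by metis
  then obtain J where J: "\<And>j f. coord_dz A (V, \<tau>) j x f = (\<Sum>k\<in>UNIV. J j k * coord_dz A (U, \<phi>) k x f)"
    by metis
  have "v f = (\<Sum>k\<in>UNIV. (\<Sum>j\<in>UNIV. b j * J j k) * coord_dz A (U, \<phi>) k x f)" for f
    unfolding b J sum_distrib_left sum_distrib_right
    by (subst sum.swap) (simp add: mult.assoc)
  then show ?thesis by (rule that)
qed

lemma coord_dz_coordinate:
  assumes c: "(U, \<phi>) \<in> A" "x \<in> U"
  shows "coord_dz A (U, \<phi>) k x (\<lambda>y. \<phi> y $ j) = (if k = j then 1 else 0)"
proof -
  have sm: "smooth_near A x (\<lambda>y. \<phi> y $ j)"
    by (rule smooth_nearI[OF chart_open[OF c(1)] c(2) smooth_on_coordinate[OF c(1)]])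
  have "frechet_derivative ((\<lambda>y. \<phi> y $ j) \<circ> inv_into U \<phi>) (at (\<phi> x)) =
      frechet_derivative (\<lambda>z. z $ j) (at (\<phi> x))"
    by (rule frechet_derivative_cong_open[OF chart_image_open[OF c(1) chart_open[OF c(1)]]])
       (use c chart_inj[OF c(1)] in auto)
  also have "\<dots> = (\<lambda>z. z $ j)"
    by (rule frechet_derivative_at[symmetric, OF bounded_linear_imp_has_derivative[OF bounded_linear_vec_nth]])
  finally show ?thesis using sm by (simp add: coord_dz_def wirtinger_def axis_def)
qed

text \<open>The coefficients in a chart are the values on the coordinate functions, so the coefficients of a
smooth field are smooth.\<close>

lemma T10_expand:
  assumes v: "v \<in> T10 A x" and c: "(U, \<phi>) \<in> A" "x \<in> U"
  shows "v f = (\<Sum>k\<in>UNIV. v (\<lambda>y. \<phi> y $ k) * coord_dz A (U, \<phi>) k x f)"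
proof -
  obtain a where a: "\<And>f. v f = (\<Sum>k\<in>UNIV. a k * coord_dz A (U, \<phi>) k x f)"
    using T10_in_chart[OF v c] by blast
  have "v (\<lambda>y. \<phi> y $ k) = a k" for k
    unfolding a by (simp add: coord_dz_coordinate[OF c] if_distrib sum.delta cong: if_cong)
  then show ?thesis using a[of f] by simp
qed

lemma T01_expand:
  assumes w: "w \<in> T01 A x" and c: "(U, \<phi>) \<in> A" "x \<in> U"
  shows "w f = (\<Sum>k\<in>UNIV. w (\<lambda>y. cnj (\<phi> y $ k)) * coord_dzbar A (U, \<phi>) k x f)"
  using T10_expand[OF conj_vec_T01[OF w] c, of "\<lambda>y. cnj (f y)"] c
  by (simp add: conj_vec_conj_eq[of w f] conj_vec_conj_eq[of w "\<lambda>y. cnj (\<phi> y $ _)"] coord_dzbar_cnj)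

lemma smooth_field10_conj:
  assumes "smooth_field10 A U \<beta>"
  shows "smooth_field A U (\<lambda>y. conj_vec (\<beta> y))" "\<And>y. y \<in> U \<Longrightarrow> conj_vec (\<beta> y) \<in> T01 A y"
proof -
  have \<beta>: "\<And>y. y \<in> U \<Longrightarrow> \<beta> y \<in> T10 A y"
    and sm: "\<And>W f. open W \<Longrightarrow> W \<subseteq> U \<Longrightarrow> smooth_on A W f \<Longrightarrow> smooth_on A W (\<lambda>x. \<beta> x f)"
    using assms unfolding smooth_field10_def smooth_field_def by auto
  show T: "\<And>y. y \<in> U \<Longrightarrow> conj_vec (\<beta> y) \<in> T01 A y" using conj_vec_T10 \<beta> by blast
  have "smooth_on A W (\<lambda>x. conj_vec (\<beta> x) f)" if "open W" "W \<subseteq> U" "smooth_on A W f" for W f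
    unfolding conj_vec_def
    by (rule smooth_on_cnj[OF that(1) sm[OF that(1,2) smooth_on_cnj[OF that(1,3)]]])
  then show "smooth_field A U (\<lambda>y. conj_vec (\<beta> y))"
    unfolding smooth_field_def using subsetD[OF T01_subset_TC T] by simp
qed

lemma smooth_fieldD:
  assumes "smooth_field A U \<xi>" "open W" "W \<subseteq> U" "smooth_on A W f"
  shows "smooth_on A W (\<lambda>x. \<xi> x f)"
  using assms unfolding smooth_field_def by blast

text \<open>With \<open>\<alpha> = \<Sum> a\<^sub>k \<partial>\<^sub>k\<close> and \<open>\<eta> = \<Sum> b\<^sub>j \<partial>\<close>bar\<open>\<^sub>j\<close>, the product rule produces the first order terms
displayed and the second order terms \<open>a\<^sub>k b\<^sub>j \<partial>\<^sub>k \<partial>\<close>bar\<open>\<^sub>j f\<close>, which cancel because the Wirtinger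
operators commute.\<close>

lemma bracket_in_chart:
  assumes U: "open U" "x \<in> U" and \<alpha>: "smooth_field10 A U \<alpha>" 
    and \<eta>: "smooth_field A U \<eta>" "\<And>y. y \<in> U \<Longrightarrow> \<eta> y \<in> T01 A y"
    and c: "(V, \<phi>) \<in> A" "x \<in> V" and f: "smooth_near A x f"
  shows "\<alpha> x (\<lambda>y. \<eta> y f) - \<eta> x (\<lambda>y. \<alpha> y f) =
    (\<Sum>j\<in>UNIV. \<alpha> x (\<lambda>y. \<eta> y (\<lambda>y. cnj (\<phi> y $ j))) * coord_dzbar A (V, \<phi>) j x f) -
    (\<Sum>j\<in>UNIV. \<eta> x (\<lambda>y. \<alpha> y (\<lambda>y. \<phi> y $ j)) * coord_dz A (V, \<phi>) j x f)"
proof -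
  have \<alpha>sm: "smooth_field A U \<alpha>" and \<alpha>T: "\<And>y. y \<in> U \<Longrightarrow> \<alpha> y \<in> T10 A y"
    using \<alpha> unfolding smooth_field10_def by auto
  obtain W where W: "open W" "x \<in> W" "smooth_on A W f" using f unfolding smooth_near_def by blast
  \<comment> \<open>On \<open>N\<close> the fields, the chart and the function are all available.\<close>
  define N where "N = U \<inter> V \<inter> W"
  have N: "open N" "x \<in> N" "N \<subseteq> U" "N \<subseteq> V" "N \<subseteq> W"
    using U W c chart_open[OF c(1)] by (auto simp: N_def)
  define O' where "O' = \<phi> ` (V \<inter> N)"
  have O': "open O'" "\<phi> x \<in> O'" unfolding O'_def using chart_image_open[OF c(1) N(1)] c N by auto
  define \<psi> where "\<psi> = inv_into V \<phi>"
  have \<psi>: "\<psi> z \<in> N" "\<phi> (\<psi> z) = z" if "z \<in> O'" for z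
    using that chart_inj[OF c(1)] by (auto simp: O'_def \<psi>_def)
  have \<psi>x: "\<psi> (\<phi> x) = x" using chart_inj[OF c] by (simp add: \<psi>_def)
  have smf: "smooth_on A N f" using smooth_on_subset[OF W(3) N(5)] .
  have coord: "smooth_on A N (\<lambda>y. \<phi> y $ j)" for j
    using smooth_on_subset[OF smooth_on_coordinate[OF c(1)] N(4)] .
  define a where "a j y = \<alpha> y (\<lambda>y. \<phi> y $ j)" for j y
  define b where "b j y = \<eta> y (\<lambda>y. cnj (\<phi> y $ j))" for j y
  have sma: "smooth_on A N (a j)" for j
    unfolding a_def by (rule smooth_fieldD[OF \<alpha>sm N(1,3) coord])
  have smb: "smooth_on A N (b j)" for j
    unfolding b_def by (rule smooth_fieldD[OF \<eta>(1) N(1,3) smooth_on_cnj[OF N(1) coord]])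
  define F where "F = (\<lambda>z. f (\<psi> z))"
  have Ck: "Ck_on k O' (\<lambda>z. g (\<psi> z))" if "smooth_on A N g" for g :: "'x \<Rightarrow> complex" and k
    unfolding O'_def \<psi>_def by (rule smooth_onD[OF that c(1)])
  have diff: "g differentiable (at (\<phi> x))" if "Ck_on (Suc 0) O' g" for g :: "complex^'n \<Rightarrow> complex"
    using that O'(2) by simp
  have F: "Ck_on k O' F" for k unfolding F_def by (rule Ck[OF smf])
  have \<eta>g: "\<eta> y g = (\<Sum>j\<in>UNIV. b j y * wirtinger_bar j (\<lambda>z. g (\<psi> z)) (\<phi> y))"
    if "y \<in> N" "smooth_on A N g" for y g
  proof -
    have "smooth_near A y g" by (rule smooth_nearI[OF N(1) that])
    then show ?thesis using T01_expand[OF \<eta>(2) c(1), of y g] that N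
      by (auto simp: b_def coord_dzbar_def comp_def \<psi>_def)
  qed
  have \<alpha>g: "\<alpha> y g = (\<Sum>j\<in>UNIV. a j y * wirtinger j (\<lambda>z. g (\<psi> z)) (\<phi> y))"
    if "y \<in> N" "smooth_on A N g" for y g
  proof -
    have "smooth_near A y g" by (rule smooth_nearI[OF N(1) that])
    then show ?thesis using T10_expand[OF \<alpha>T c(1), of y g] that N
      by (auto simp: a_def coord_dz_def comp_def \<psi>_def)
  qed
  define a' b' where "a' j = (\<lambda>z. a j (\<psi> z))" and "b' j = (\<lambda>z. b j (\<psi> z))" for j
  have w1: "wirtinger k (\<lambda>z. \<eta> (\<psi> z) f) (\<phi> x) =
      (\<Sum>j\<in>UNIV. wirtinger k (b' j) (\<phi> x) * wirtinger_bar j F (\<phi> x)) +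
      (\<Sum>j\<in>UNIV. b j x * wirtinger k (wirtinger_bar j F) (\<phi> x))" for k
  proof -
    have "wirtinger k (\<lambda>z. \<eta> (\<psi> z) f) (\<phi> x) =
        wirtinger k (\<lambda>z. \<Sum>j\<in>UNIV. b' j z * wirtinger_bar j F z) (\<phi> x)"
      by (rule wirtinger_cong_open(1)[OF O'])
         (simp add: \<eta>g[OF _ smf] \<psi> F_def b'_def)
    also have "\<dots> = (\<Sum>j\<in>UNIV. wirtinger k (b' j) (\<phi> x) * wirtinger_bar j F (\<phi> x)) +
        (\<Sum>j\<in>UNIV. b' j (\<phi> x) * wirtinger k (wirtinger_bar j F) (\<phi> x))"
      unfolding b'_def
      by (rule wirtinger_sum_mult(1)) (intro diff Ck smb Ck_on_wirtinger O' F)+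
    finally show ?thesis by (simp add: b'_def \<psi>x)
  qed
  have w2: "wirtinger_bar k (\<lambda>z. \<alpha> (\<psi> z) f) (\<phi> x) =
      (\<Sum>j\<in>UNIV. wirtinger_bar k (a' j) (\<phi> x) * wirtinger j F (\<phi> x)) +
      (\<Sum>j\<in>UNIV. a j x * wirtinger_bar k (wirtinger j F) (\<phi> x))" for k
  proof -
    have "wirtinger_bar k (\<lambda>z. \<alpha> (\<psi> z) f) (\<phi> x) =
        wirtinger_bar k (\<lambda>z. \<Sum>j\<in>UNIV. a' j z * wirtinger j F z) (\<phi> x)"
      by (rule wirtinger_cong_open(2)[OF O'])
         (simp add: \<alpha>g[OF _ smf] \<psi> F_def a'_def)
    also have "\<dots> = (\<Sum>j\<in>UNIV. wirtinger_bar k (a' j) (\<phi> x) * wirtinger j F (\<phi> x)) +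
        (\<Sum>j\<in>UNIV. a' j (\<phi> x) * wirtinger_bar k (wirtinger j F) (\<phi> x))"
      unfolding a'_def
      by (rule wirtinger_sum_mult(2)) (intro diff Ck sma Ck_on_wirtinger O' F)+
    finally show ?thesis by (simp add: a'_def \<psi>x)
  qed
  have "\<alpha> x (\<lambda>y. \<eta> y f) = (\<Sum>k\<in>UNIV. a k x * wirtinger k (\<lambda>z. \<eta> (\<psi> z) f) (\<phi> x))"
    by (rule \<alpha>g[OF N(2) smooth_fieldD[OF \<eta>(1) N(1,3) smf]])
  also have "\<dots> = (\<Sum>k\<in>UNIV. \<Sum>j\<in>UNIV. a k x * wirtinger k (b' j) (\<phi> x) * wirtinger_bar j F (\<phi> x)) +
      (\<Sum>k\<in>UNIV. \<Sum>j\<in>UNIV. a k x * b j x * wirtinger k (wirtinger_bar j F) (\<phi> x))"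
    by (simp add: w1 distrib_left sum.distrib sum_distrib_left mult.assoc)
  also have "(\<Sum>k\<in>UNIV. \<Sum>j\<in>UNIV. a k x * wirtinger k (b' j) (\<phi> x) * wirtinger_bar j F (\<phi> x)) =
      (\<Sum>j\<in>UNIV. \<alpha> x (b j) * wirtinger_bar j F (\<phi> x))"
    by (subst sum.swap) (simp add: \<alpha>g[OF N(2) smb] b'_def sum_distrib_right)
  finally have 1: "\<alpha> x (\<lambda>y. \<eta> y f) = (\<Sum>j\<in>UNIV. \<alpha> x (b j) * wirtinger_bar j F (\<phi> x)) +
      (\<Sum>k\<in>UNIV. \<Sum>j\<in>UNIV. a k x * b j x * wirtinger k (wirtinger_bar j F) (\<phi> x))" .
  have "\<eta> x (\<lambda>y. \<alpha> y f) = (\<Sum>k\<in>UNIV. b k x * wirtinger_bar k (\<lambda>z. \<alpha> (\<psi> z) f) (\<phi> x))"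
    by (rule \<eta>g[OF N(2) smooth_fieldD[OF \<alpha>sm N(1,3) smf]])
  also have "\<dots> = (\<Sum>k\<in>UNIV. \<Sum>j\<in>UNIV. b k x * wirtinger_bar k (a' j) (\<phi> x) * wirtinger j F (\<phi> x)) +
      (\<Sum>k\<in>UNIV. \<Sum>j\<in>UNIV. b k x * a j x * wirtinger_bar k (wirtinger j F) (\<phi> x))"
    by (simp add: w2 distrib_left sum.distrib sum_distrib_left mult.assoc)
  also have "(\<Sum>k\<in>UNIV. \<Sum>j\<in>UNIV. b k x * wirtinger_bar k (a' j) (\<phi> x) * wirtinger j F (\<phi> x)) =
      (\<Sum>j\<in>UNIV. \<eta> x (a j) * wirtinger j F (\<phi> x))"
    by (subst sum.swap) (simp add: \<eta>g[OF N(2) sma] a'_def sum_distrib_right)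
  also have "(\<Sum>k\<in>UNIV. \<Sum>j\<in>UNIV. b k x * a j x * wirtinger_bar k (wirtinger j F) (\<phi> x)) =
      (\<Sum>k\<in>UNIV. \<Sum>j\<in>UNIV. a k x * b j x * wirtinger k (wirtinger_bar j F) (\<phi> x))"
    by (subst sum.swap) (simp add: wirtinger_commute[OF O' F] mult.commute)
  finally have 2: "\<eta> x (\<lambda>y. \<alpha> y f) = (\<Sum>j\<in>UNIV. \<eta> x (a j) * wirtinger j F (\<phi> x)) +
      (\<Sum>k\<in>UNIV. \<Sum>j\<in>UNIV. a k x * b j x * wirtinger k (wirtinger_bar j F) (\<phi> x))" .
  have "coord_dz A (V, \<phi>) j x f = wirtinger j F (\<phi> x)"
    "coord_dzbar A (V, \<phi>) j x f = wirtinger_bar j F (\<phi> x)" for j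
    using f by (simp_all add: coord_dz_def coord_dzbar_def F_def \<psi>_def comp_def)
  then show ?thesis by (simp add: 1 2 a_def[abs_def] b_def[abs_def])
qed

text \<open>A connection is only additive on \<open>TC\<close>, so its value on the bracket can be analysed only because the
bracket is again a tangent vector.\<close>

lemma lie_bracket_TC:
  assumes U: "open U" "x \<in> U" and \<alpha>: "smooth_field10 A U \<alpha>"
    and \<eta>: "smooth_field A U \<eta>" "\<And>y. y \<in> U \<Longrightarrow> \<eta> y \<in> T01 A y"
  shows "lie_bracket A \<alpha> \<eta> x \<in> TC A x"
proof -
  obtain V \<phi> where c: "(V, \<phi>) \<in> A" "x \<in> V" using chart_at .
  define p q where "p j = - \<eta> x (\<lambda>y. \<alpha> y (\<lambda>y. \<phi> y $ j))"
    and "q j = \<alpha> x (\<lambda>y. \<eta> y (\<lambda>y. cnj (\<phi> y $ j)))" for j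
  have "lie_bracket A \<alpha> \<eta> x f =
      (\<Sum>j\<in>UNIV. p j * coord_dz A (V, \<phi>) j x f) + (\<Sum>j\<in>UNIV. q j * coord_dzbar A (V, \<phi>) j x f)" for f
  proof (cases "smooth_near A x f")
    case True
    then show ?thesis
      using bracket_in_chart[OF U \<alpha> \<eta> c True]
      by (simp add: lie_bracket_def p_def q_def sum_negf)
  next
    case False
    then show ?thesis by (simp add: lie_bracket_def coord_dz_def coord_dzbar_def)
  qed
  then have "lie_bracket A \<alpha> \<eta> x = (\<lambda>f. (\<Sum>j\<in>UNIV. p j * coord_dz A (V, \<phi>) j x f) +
      (\<Sum>j\<in>UNIV. q j * coord_dzbar A (V, \<phi>) j x f))" by blast
  moreover have "(\<lambda>f. \<Sum>j\<in>UNIV. p j * coord_dz A (V, \<phi>) j x f) \<in> T10 A x"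
    unfolding T10_def using c by (auto intro!: bexI[of _ "(V, \<phi>)"])
  moreover have "(\<lambda>f. \<Sum>j\<in>UNIV. q j * coord_dzbar A (V, \<phi>) j x f) \<in> T01 A x"
    unfolding T01_def using c by (auto intro!: bexI[of _ "(V, \<phi>)"])
  ultimately show ?thesis unfolding TC_def mem_Collect_eq by (intro bexI)
qed

end

section \<open>Sections of a holomorphic vector bundle\<close>

locale hol_bundle = complex_mfd A
  for A :: "('x::topological_space, 'n::finite) chart set" +
  fixes E :: "('x, 'v::ab_group_add, 'r::finite) vbundle"
  assumes hvb: "holomorphic_vector_bundle A E"
begin

abbreviation frame :: "('x \<Rightarrow> 'v \<Rightarrow> complex^'r) \<Rightarrow> complex^'r \<Rightarrow> 'x \<Rightarrow> 'v" where
  "frame \<psi> e x \<equiv> inv_into (fibre E x) (\<psi> x) e"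

lemma module_vscale: "module (vscale E)"
proof -
  have "vector_space (vscale E)" using hvb[unfolded holomorphic_vector_bundle_def] by (elim conjE)
  then show ?thesis by (simp only: module_iff_vector_space)
qed

lemma subspace_fibre: "module.subspace (vscale E) (fibre E x)"
  using hvb[unfolded holomorphic_vector_bundle_def] by (elim conjE) (rule spec)

lemma fibre_0: "0 \<in> fibre E x"
  using module.subspace_0[OF module_vscale subspace_fibre] .

lemma fibre_add: "u \<in> fibre E x \<Longrightarrow> w \<in> fibre E x \<Longrightarrow> u + w \<in> fibre E x"
  using module.subspace_add[OF module_vscale subspace_fibre] .

lemma fibre_diff: "u \<in> fibre E x \<Longrightarrow> w \<in> fibre E x \<Longrightarrow> u - w \<in> fibre E x"
  using module.subspace_diff[OF module_vscale subspace_fibre] .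

lemma fibre_scale: "u \<in> fibre E x \<Longrightarrow> vscale E c u \<in> fibre E x"
  using module.subspace_scale[OF module_vscale subspace_fibre] .

lemma fibre_sum: "(\<And>i. i \<in> I \<Longrightarrow> f i \<in> fibre E x) \<Longrightarrow> (\<Sum>i\<in>I. f i) \<in> fibre E x"
  using module.subspace_sum[OF module_vscale subspace_fibre] .

lemma triv_at:
  obtains V \<psi> where "(V, \<psi>) \<in> trivs E" "x \<in> V"
proof -
  have "(\<Union>(U, \<psi>)\<in>trivs E. U) = UNIV"
    using hvb[unfolded holomorphic_vector_bundle_def] by (elim conjE)
  then have "x \<in> (\<Union>(U, \<psi>)\<in>trivs E. U)" by simp
  then show ?thesis using that by auto
qed

lemma triv_props:
  assumes "(V, \<psi>) \<in> trivs E"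
  shows "open V" and "\<forall>x\<in>V. bij_betw (\<psi> x) (fibre E x) UNIV \<and>
    (\<forall>u\<in>fibre E x. \<forall>w\<in>fibre E x. \<psi> x (u + w) = \<psi> x u + \<psi> x w) \<and>
    (\<forall>c. \<forall>u\<in>fibre E x. \<psi> x (vscale E c u) = c *s \<psi> x u)"
proof -
  have "\<forall>(U, \<psi>)\<in>trivs E. open U \<and>
      (\<forall>x\<in>U. bij_betw (\<psi> x) (fibre E x) UNIV \<and>
        (\<forall>u\<in>fibre E x. \<forall>w\<in>fibre E x. \<psi> x (u + w) = \<psi> x u + \<psi> x w) \<and>
        (\<forall>c. \<forall>u\<in>fibre E x. \<psi> x (vscale E c u) = c *s \<psi> x u))"
    using hvb[unfolded holomorphic_vector_bundle_def] by (elim conjE)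
  from bspec[OF this assms]
  show "open V" "\<forall>x\<in>V. bij_betw (\<psi> x) (fibre E x) UNIV \<and>
    (\<forall>u\<in>fibre E x. \<forall>w\<in>fibre E x. \<psi> x (u + w) = \<psi> x u + \<psi> x w) \<and>
    (\<forall>c. \<forall>u\<in>fibre E x. \<psi> x (vscale E c u) = c *s \<psi> x u)"
    by simp_all
qed

lemmas triv_open = triv_props(1)

lemma triv_bij: "(V, \<psi>) \<in> trivs E \<Longrightarrow> x \<in> V \<Longrightarrow> bij_betw (\<psi> x) (fibre E x) UNIV"
  by (drule triv_props(2)) simp

lemma triv_add: "(V, \<psi>) \<in> trivs E \<Longrightarrow> x \<in> V \<Longrightarrow> u \<in> fibre E x \<Longrightarrow> w \<in> fibre E x \<Longrightarrow>
    \<psi> x (u + w) = \<psi> x u + \<psi> x w"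
  by (drule triv_props(2)) simp

lemma triv_scale: "(V, \<psi>) \<in> trivs E \<Longrightarrow> x \<in> V \<Longrightarrow> u \<in> fibre E x \<Longrightarrow>
    \<psi> x (vscale E c u) = c *s \<psi> x u"
  by (drule triv_props(2)) simp

lemma frame_holomorphic:
  assumes "(V, \<psi>) \<in> trivs E" "(W, \<tau>) \<in> trivs E"
  shows "holomorphic_map_on A (V \<inter> W) (\<lambda>x. \<tau> x (frame \<psi> e x))"
proof -
  have "\<forall>(U, \<psi>)\<in>trivs E. \<forall>(V, \<tau>)\<in>trivs E. \<forall>e.
      holomorphic_map_on A (U \<inter> V) (\<lambda>x. \<tau> x (inv_into (fibre E x) (\<psi> x) e))"
    using hvb[unfolded holomorphic_vector_bundle_def] by (elim conjE)
  from bspec[OF this assms(1)] have "\<forall>(W, \<tau>)\<in>trivs E. \<forall>e.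
      holomorphic_map_on A (V \<inter> W) (\<lambda>x. \<tau> x (frame \<psi> e x))" by simp
  from bspec[OF this assms(2)] show ?thesis by simp
qed

lemma triv_zero: "(V, \<psi>) \<in> trivs E \<Longrightarrow> x \<in> V \<Longrightarrow> \<psi> x 0 = 0"
  using triv_add[of V \<psi> x 0 0] fibre_0 by simp

lemma triv_inj: "(V, \<psi>) \<in> trivs E \<Longrightarrow> x \<in> V \<Longrightarrow> u \<in> fibre E x \<Longrightarrow> w \<in> fibre E x \<Longrightarrow>
    \<psi> x u = \<psi> x w \<Longrightarrow> u = w"
  using triv_bij unfolding bij_betw_def inj_on_def by blast

lemma triv_sum:
  assumes "(V, \<psi>) \<in> trivs E" "x \<in> V" "\<And>i. i \<in> I \<Longrightarrow> f i \<in> fibre E x"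
  shows "\<psi> x (\<Sum>i\<in>I. f i) = (\<Sum>i\<in>I. \<psi> x (f i))"
  using assms(3)
proof (induction I rule: infinite_finite_induct)
  case (insert i I)
  then show ?case using triv_add[OF assms(1,2), of "f i" "\<Sum>i\<in>I. f i"] fibre_sum[of I f x] by simp
qed (simp_all add: triv_zero[OF assms(1,2)])

lemma frame_fibre: "(V, \<psi>) \<in> trivs E \<Longrightarrow> x \<in> V \<Longrightarrow> frame \<psi> e x \<in> fibre E x"
  using triv_bij[of V \<psi> x] by (auto simp: bij_betw_def intro!: inv_into_into)

lemma triv_frame: "(V, \<psi>) \<in> trivs E \<Longrightarrow> x \<in> V \<Longrightarrow> \<psi> x (frame \<psi> e x) = e"
  using triv_bij[of V \<psi> x] by (auto simp: bij_betw_def intro!: f_inv_into_f)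

lemma frame_triv: "(V, \<psi>) \<in> trivs E \<Longrightarrow> x \<in> V \<Longrightarrow> u \<in> fibre E x \<Longrightarrow> frame \<psi> (\<psi> x u) x = u"
  using triv_bij[of V \<psi> x] by (auto simp: bij_betw_def)

lemma frame_expand:
  assumes "(V, \<psi>) \<in> trivs E" "x \<in> V" "u \<in> fibre E x"
  shows "u = (\<Sum>i\<in>UNIV. vscale E (\<psi> x u $ i) (frame \<psi> (axis i 1) x))"
proof (rule triv_inj[OF assms])
  show "(\<Sum>i\<in>UNIV. vscale E (\<psi> x u $ i) (frame \<psi> (axis i 1) x)) \<in> fibre E x"
    by (intro fibre_sum fibre_scale frame_fibre[OF assms(1,2)])
  have "\<psi> x (\<Sum>i\<in>UNIV. vscale E (\<psi> x u $ i) (frame \<psi> (axis i 1) x)) =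
      (\<Sum>i\<in>UNIV. \<psi> x u $ i *s axis i 1)"
    by (simp add: triv_sum[OF assms(1,2)] fibre_scale frame_fibre[OF assms(1,2)]
        triv_scale[OF assms(1,2)] triv_frame[OF assms(1,2)])
  also have "\<dots> = \<psi> x u" by (simp add: basis_expansion)
  finally show "\<psi> x u = \<psi> x (\<Sum>i\<in>UNIV. vscale E (\<psi> x u $ i) (frame \<psi> (axis i 1) x))" ..
qed

lemma smooth_sectionI:
  assumes "\<And>x. x \<in> U \<Longrightarrow> s x \<in> fibre E x"
    and "\<And>V \<psi>. (V, \<psi>) \<in> trivs E \<Longrightarrow> smooth_on A (U \<inter> V) (\<lambda>x. \<psi> x (s x))"
  shows "smooth_section A E U s"
  using assms unfolding smooth_section_def by blast

lemma smooth_section_fibre: "smooth_section A E U s \<Longrightarrow> x \<in> U \<Longrightarrow> s x \<in> fibre E x"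
  unfolding smooth_section_def by blast

lemma smooth_section_triv:
  "smooth_section A E U s \<Longrightarrow> (V, \<psi>) \<in> trivs E \<Longrightarrow> smooth_on A (U \<inter> V) (\<lambda>x. \<psi> x (s x))"
  unfolding smooth_section_def by blast

lemma smooth_section_subset:
  assumes "smooth_section A E U s" "W \<subseteq> U"
  shows "smooth_section A E W s"
proof (rule smooth_sectionI)
  show "s x \<in> fibre E x" if "x \<in> W" for x using smooth_section_fibre assms that by blast
  show "smooth_on A (W \<inter> V) (\<lambda>x. \<psi> x (s x))" if "(V, \<psi>) \<in> trivs E" for V \<psi>
    by (rule smooth_on_subset[OF smooth_section_triv[OF assms(1) that]]) (use assms(2) in auto)
qed

lemma smooth_section_add:
  assumes "open U" "smooth_section A E U s" "smooth_section A E U t"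
  shows "smooth_section A E U (\<lambda>x. s x + t x)"
proof (rule smooth_sectionI)
  show "s x + t x \<in> fibre E x" if "x \<in> U" for x
    using fibre_add smooth_section_fibre assms that by blast
  show "smooth_on A (U \<inter> V) (\<lambda>x. \<psi> x (s x + t x))" if V: "(V, \<psi>) \<in> trivs E" for V \<psi>
  proof (rule smooth_on_cong[OF _ _ smooth_on_add[OF _ smooth_section_triv[OF assms(2) V]
          smooth_section_triv[OF assms(3) V]]])
    show "open (U \<inter> V)" "open (U \<inter> V)" using assms(1) triv_open[OF V] by auto
    show "\<psi> x (s x) + \<psi> x (t x) = \<psi> x (s x + t x)" if "x \<in> U \<inter> V" for x
      using triv_add[OF V] smooth_section_fibre assms(2,3) that by (metis IntD1 IntD2)
  qed
qed

text \<open>Constant sections of a trivialisation are smooth in every other trivialisation because the transition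
maps are holomorphic, hence smooth.\<close>

lemma smooth_section_frame:
  assumes "(V, \<psi>) \<in> trivs E"
  shows "smooth_section A E V (frame \<psi> e)"
proof (rule smooth_sectionI)
  show "frame \<psi> e x \<in> fibre E x" if "x \<in> V" for x using frame_fibre[OF assms that] .
  fix W \<tau> assume W: "(W, \<tau>) \<in> trivs E"
  have "holomorphic_map_on A (V \<inter> W) (\<lambda>x. \<tau> x (frame \<psi> e x))"
    by (rule frame_holomorphic[OF assms W])
  then show "smooth_on A (V \<inter> W) (\<lambda>x. \<tau> x (frame \<psi> e x))"
    by (rule holomorphic_map_on_smooth[rotated]) (use triv_open assms W in auto)
qed

text \<open>Identities tested against smooth sections therefore hold against all vectors of a fibre.\<close>

lemma section_through:
  assumes "e \<in> fibre E x"
  obtains V t where "open V" "x \<in> V" "smooth_section A E V t" "t x = e"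
proof -
  obtain V \<psi> where V: "(V, \<psi>) \<in> trivs E" "x \<in> V" using triv_at .
  show ?thesis
    by (rule that[OF triv_open[OF V(1)] V(2) smooth_section_frame[OF V(1), of "\<psi> x e"]])
       (rule frame_triv[OF V assms])
qed

section \<open>Hermitian forms\<close>

lemma herm_add_left:
  assumes "smooth_hermitian_form A E b" "s \<in> fibre E x" "s' \<in> fibre E x" "t \<in> fibre E x"
  shows "b x (s + s') t = b x s t + b x s' t"
  using assms unfolding smooth_hermitian_form_def by blast

lemma herm_scale_left:
  assumes "smooth_hermitian_form A E b" "s \<in> fibre E x" "t \<in> fibre E x"
  shows "b x (vscale E c s) t = c * b x s t"
  using assms unfolding smooth_hermitian_form_def by blast

lemma herm_sym:
  assumes "smooth_hermitian_form A E b" "s \<in> fibre E x" "t \<in> fibre E x"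
  shows "b x t s = cnj (b x s t)"
  using assms unfolding smooth_hermitian_form_def by blast

lemma herm_smooth:
  assumes "smooth_hermitian_form A E b" "open U" "smooth_section A E U s" "smooth_section A E U t"
  shows "smooth_on A U (\<lambda>x. b x (s x) (t x))"
  using assms unfolding smooth_hermitian_form_def by blast

lemma herm_diff_left:
  assumes "smooth_hermitian_form A E b" "s \<in> fibre E x" "s' \<in> fibre E x" "t \<in> fibre E x"
  shows "b x (s - s') t = b x s t - b x s' t"
  using herm_add_left[OF assms(1) fibre_diff[OF assms(2,3)] assms(3,4)] by simp

lemma herm_diff_right:
  assumes "smooth_hermitian_form A E b" "s \<in> fibre E x" "t \<in> fibre E x" "t' \<in> fibre E x"
  shows "b x s (t - t') = b x s t - b x s t'"
  using herm_diff_left[OF assms(1,3,4,2)] herm_sym[OF assms(1)] assms(2-) fibre_diff[OF assms(3,4)]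
  by (metis complex_cnj_diff)

lemma herm_zero_left:
  assumes "smooth_hermitian_form A E b" "t \<in> fibre E x"
  shows "b x 0 t = 0"
  using herm_diff_left[OF assms(1) fibre_0 fibre_0 assms(2)] by simp

lemma herm_sum_left:
  assumes "smooth_hermitian_form A E b" "\<And>i. i \<in> I \<Longrightarrow> f i \<in> fibre E x" "t \<in> fibre E x"
  shows "b x (\<Sum>i\<in>I. f i) t = (\<Sum>i\<in>I. b x (f i) t)"
  using assms(2)
proof (induction I rule: infinite_finite_induct)
  case (insert i I)
  then show ?case
    using herm_add_left[OF assms(1) _ fibre_sum[of I f x] assms(3), of "f i"] by simp
qed (simp_all add: herm_zero_left[OF assms(1,3)])

lemma herm_nondegenerate:
  assumes "smooth_hermitian_form A E h" "positive_definite E h"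
    and "u \<in> fibre E x" "w \<in> fibre E x" "\<And>t. t \<in> fibre E x \<Longrightarrow> h x u t = h x w t"
  shows "u = w"
proof -
  have m: "u - w \<in> fibre E x" using fibre_diff assms(3,4) by blast
  have "h x (u - w) (u - w) = 0"
    using herm_diff_left[OF assms(1,3,4) m] assms(5)[OF m] by simp
  then have "u - w = 0" using assms(2) m unfolding positive_definite_def by force
  then show ?thesis by simp
qed

lemma smooth_hermitian_form_add:
  assumes b1: "smooth_hermitian_form A E b1" and b2: "smooth_hermitian_form A E b2"
  shows "smooth_hermitian_form A E (\<lambda>x s t. b1 x s t + b2 x s t)"
  unfolding smooth_hermitian_form_def
proof (intro conjI allI ballI impI)
  fix x s t assume st: "s \<in> fibre E x" "t \<in> fibre E x"
  show "b1 x (s + s') t + b2 x (s + s') t = b1 x s t + b2 x s t + (b1 x s' t + b2 x s' t)"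
    if "s' \<in> fibre E x" for s'
    using herm_add_left[OF b1 st(1) that st(2)] herm_add_left[OF b2 st(1) that st(2)] by simp
  show "b1 x (vscale E c s) t + b2 x (vscale E c s) t = c * (b1 x s t + b2 x s t)" for c
    using herm_scale_left[OF b1 st] herm_scale_left[OF b2 st] by (simp add: algebra_simps)
  show "b1 x t s + b2 x t s = cnj (b1 x s t + b2 x s t)"
    using herm_sym[OF b1 st] herm_sym[OF b2 st] by simp
next
  fix U s t assume "open U" "smooth_section A E U s" "smooth_section A E U t"
  then show "smooth_on A U (\<lambda>x. b1 x (s x) (t x) + b2 x (s x) (t x))"
    by (intro smooth_on_add herm_smooth b1 b2)
qed

text \<open>The transpose of the usual Gram matrix of the frame, so that it acts on coefficient vectors from the
left.\<close>

definition gram :: "('x \<Rightarrow> 'v \<Rightarrow> 'v \<Rightarrow> complex) \<Rightarrow> ('x \<Rightarrow> 'v \<Rightarrow> complex^'r) \<Rightarrow> 'x \<Rightarrow> complex^'r^'r" where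
  "gram h \<psi> x = (\<chi> i j. h x (frame \<psi> (axis j 1) x) (frame \<psi> (axis i 1) x))"

lemma gram_mult:
  assumes h: "smooth_hermitian_form A E h" and V: "(V, \<psi>) \<in> trivs E" "x \<in> V" and u: "u \<in> fibre E x"
  shows "(gram h \<psi> x *v \<psi> x u) $ i = h x u (frame \<psi> (axis i 1) x)"
proof -
  have "h x u (frame \<psi> (axis i 1) x) =
      h x (\<Sum>j\<in>UNIV. vscale E (\<psi> x u $ j) (frame \<psi> (axis j 1) x)) (frame \<psi> (axis i 1) x)"
    using frame_expand[OF V u] by simp
  also have "\<dots> = (\<Sum>j\<in>UNIV. \<psi> x u $ j * h x (frame \<psi> (axis j 1) x) (frame \<psi> (axis i 1) x))"
    by (simp add: herm_sum_left[OF h] fibre_scale frame_fibre[OF V] herm_scale_left[OF h])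
  finally show ?thesis by (simp add: matrix_vector_mult_def gram_def mult.commute)
qed

text \<open>Both sides are conjugate linear in the second argument, which is tested on a basis.\<close>

lemma herm_eq_on_frame:
  assumes h: "smooth_hermitian_form A E h" and b: "smooth_hermitian_form A E b"
    and V: "(V, \<psi>) \<in> trivs E" "x \<in> V" and u: "u \<in> fibre E x" and w: "w \<in> fibre E x"
    and eq: "\<And>i. h x u (frame \<psi> (axis i 1) x) = b x w (frame \<psi> (axis i 1) x)"
    and t: "t \<in> fibre E x"
  shows "h x u t = b x w t"
proof -
  have exp: "g x t v = (\<Sum>j\<in>UNIV. \<psi> x t $ j * g x (frame \<psi> (axis j 1) x) v)"
    if g: "smooth_hermitian_form A E g" and v: "v \<in> fibre E x" for g v
    by (subst frame_expand[OF V t])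
       (simp add: herm_sum_left[OF g] fibre_scale frame_fibre[OF V] herm_scale_left[OF g] v)
  have "h x t u = b x t w"
    unfolding exp[OF h u] exp[OF b w]
    using eq herm_sym[OF h u frame_fibre[OF V]] herm_sym[OF b w frame_fibre[OF V]] by simp
  then show ?thesis using herm_sym[OF h t u] herm_sym[OF b t w] by simp
qed

lemma det_gram:
  assumes h: "smooth_hermitian_form A E h" "positive_definite E h" and V: "(V, \<psi>) \<in> trivs E" "x \<in> V"
  shows "det (gram h \<psi> x) \<noteq> 0"
proof -
  have "u = 0" if "gram h \<psi> x *v u = 0" for u
  proof -
    define w where "w = frame \<psi> u x"
    have w: "w \<in> fibre E x" "\<psi> x w = u" unfolding w_def using frame_fibre[OF V] triv_frame[OF V] by auto
    have "h x w (frame \<psi> (axis i 1) x) = h x 0 (frame \<psi> (axis i 1) x)" for i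
      using gram_mult[OF h(1) V w(1)] that w(2) herm_zero_left[OF h(1) frame_fibre[OF V]] by simp
    then have "h x w t = h x 0 t" if "t \<in> fibre E x" for t
      using herm_eq_on_frame[OF h(1) h(1) V w(1) fibre_0 _ that] by blast
    then have "w = 0" using herm_nondegenerate[OF h w(1) fibre_0] by blast
    then show ?thesis using w(2) triv_zero[OF V] by simp
  qed
  then show ?thesis
    using invertible_det_nz[of "gram h \<psi> x"] invertible_left_inverse[of "gram h \<psi> x"]
      matrix_left_invertible_ker[of "gram h \<psi> x"] by metis
qed

text \<open>In a frame, the equation \<open>h(u, t) = b(s, t)\<close> for all \<open>t\<close> is a linear system whose matrix is the Gram
matrix of \<open>h\<close>. Cramer's rule solves it by a formula from which the smooth dependence of the solution on
the point can be read off.\<close>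

lemma inv_comp_cramer:
  assumes h: "smooth_hermitian_form A E h" "positive_definite E h" and b: "smooth_hermitian_form A E b"
    and V: "(V, \<psi>) \<in> trivs E" "x \<in> V" and s: "s \<in> fibre E x"
  shows "inv_comp E h b x s = frame \<psi> (\<chi> k. det (\<chi> i j. if j = k
      then b x s (frame \<psi> (axis i 1) x) else gram h \<psi> x $ i $ j) / det (gram h \<psi> x)) x" (is "_ = frame \<psi> ?u x")
    and "inv_comp E h b x s \<in> fibre E x"
    and "t \<in> fibre E x \<Longrightarrow> h x (inv_comp E h b x s) t = b x s t"
proof -
  define c where "c = (\<chi> i. b x s (frame \<psi> (axis i 1) x))"
  define w where "w = frame \<psi> ?u x"
  have w: "w \<in> fibre E x" "\<psi> x w = ?u" unfolding w_def using frame_fibre[OF V] triv_frame[OF V] by auto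
  have "gram h \<psi> x *v ?u = c"
    using cramer[OF det_gram[OF h V], of ?u c] unfolding c_def vec_lambda_beta by simp
  then have "h x w (frame \<psi> (axis i 1) x) = b x s (frame \<psi> (axis i 1) x)" for i
    using gram_mult[OF h(1) V w(1), of i] w(2) by (simp add: c_def)
  then have hw: "h x w t = b x s t" if "t \<in> fibre E x" for t
    using herm_eq_on_frame[OF h(1) b V w(1) s _ that] by blast
  have "inv_comp E h b x s = w"
    unfolding inv_comp_def
  proof (rule the_equality)
    show "w \<in> fibre E x \<and> (\<forall>t\<in>fibre E x. h x w t = b x s t)" using w(1) hw by simp
    fix u assume u: "u \<in> fibre E x \<and> (\<forall>t\<in>fibre E x. h x u t = b x s t)"
    show "u = w" by (rule herm_nondegenerate[OF h _ w(1)]) (simp_all add: u hw)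
  qed
  then show "inv_comp E h b x s = frame \<psi> ?u x" "inv_comp E h b x s \<in> fibre E x"
    "t \<in> fibre E x \<Longrightarrow> h x (inv_comp E h b x s) t = b x s t"
    using w(1) hw by (simp_all add: w_def)
qed

lemma inv_comp_fibre:
  assumes "smooth_hermitian_form A E h" "positive_definite E h" "smooth_hermitian_form A E b"
    "s \<in> fibre E x"
  shows "inv_comp E h b x s \<in> fibre E x"
proof -
  obtain V \<psi> where "(V, \<psi>) \<in> trivs E" "x \<in> V" using triv_at .
  from inv_comp_cramer(2)[OF assms(1-3) this assms(4)] show ?thesis .
qed

lemma inv_comp_eq:
  assumes "smooth_hermitian_form A E h" "positive_definite E h" "smooth_hermitian_form A E b"
    "s \<in> fibre E x" "t \<in> fibre E x"
  shows "h x (inv_comp E h b x s) t = b x s t"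
proof -
  obtain V \<psi> where "(V, \<psi>) \<in> trivs E" "x \<in> V" using triv_at .
  from inv_comp_cramer(3)[OF assms(1-3) this assms(4,5)] show ?thesis .
qed

lemma smooth_section_inv_comp:
  assumes h: "smooth_hermitian_form A E h" "positive_definite E h" and b: "smooth_hermitian_form A E b"
    and U: "open U" and s: "smooth_section A E U s"
  shows "smooth_section A E U (\<lambda>x. inv_comp E h b x (s x))"
proof (rule smooth_sectionI)
  show "inv_comp E h b x (s x) \<in> fibre E x" if "x \<in> U" for x
    using inv_comp_fibre[OF h b smooth_section_fibre[OF s that]] .
  fix V \<psi> assume V: "(V, \<psi>) \<in> trivs E"
  define W where "W = U \<inter> V"
  have W: "open W" "W \<subseteq> U" "W \<subseteq> V" using U triv_open[OF V] by (auto simp: W_def)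
  have fr: "smooth_section A E W (frame \<psi> e)" for e
    using smooth_section_subset[OF smooth_section_frame[OF V] W(3)] .
  have sW: "smooth_section A E W s" using smooth_section_subset[OF s W(2)] .
  have gram: "smooth_on A W (\<lambda>x. gram h \<psi> x $ i $ j)" for i j
    unfolding gram_def by (simp add: herm_smooth[OF h(1) W(1) fr fr])
  have num: "smooth_on A W (\<lambda>x. det (\<chi> i j. if j = k
      then b x (s x) (frame \<psi> (axis i 1) x) else gram h \<psi> x $ i $ j))" for k
  proof (rule smooth_on_det[OF W(1)])
    fix i j
    show "smooth_on A W (\<lambda>x. (\<chi> i j. if j = k
      then b x (s x) (frame \<psi> (axis i 1) x) else gram h \<psi> x $ i $ j) $ i $ j)"
      using gram[of i j] herm_smooth[OF b W(1) sW fr] by (cases "j = k") simp_all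
  qed
  have inv: "smooth_on A W (\<lambda>x. inverse (det (gram h \<psi> x)))"
    by (rule smooth_on_inverse[OF W(1) smooth_on_det[OF W(1) gram]])
       (use det_gram[OF h V] W(3) in auto)
  have "smooth_on A W (\<lambda>x. \<chi> k. det (\<chi> i j. if j = k
      then b x (s x) (frame \<psi> (axis i 1) x) else gram h \<psi> x $ i $ j) / det (gram h \<psi> x))"
    by (rule smooth_on_vec[OF W(1)])
       (simp add: divide_inverse smooth_on_mult[OF W(1) num inv])
  then show "smooth_on A (U \<inter> V) (\<lambda>x. \<psi> x (inv_comp E h b x (s x)))"
    unfolding W_def[symmetric]
    by (rule smooth_on_cong[OF W(1), rotated])
       (use W inv_comp_cramer(1)[OF h b V] smooth_section_fibre[OF sW] triv_frame[OF V] in auto)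
qed


section \<open>Chern connections\<close>

lemma connection_at:
  assumes "connection A E D" "open U" "smooth_section A E U s"
  shows "\<forall>x\<in>U. \<forall>u\<in>TC A x. \<forall>v\<in>TC A x. \<forall>c.
      D s x v \<in> fibre E x \<and>
      D s x (\<lambda>f. u f + v f) = D s x u + D s x v \<and>
      D s x (\<lambda>f. c * v f) = vscale E c (D s x v)" (is ?point)
    and "\<forall>\<xi>. smooth_field A U \<xi> \<longrightarrow> smooth_section A E U (\<lambda>x. D s x (\<xi> x))" (is ?smooth)
    and "\<forall>t. smooth_section A E U t \<longrightarrow>
      (\<forall>x\<in>U. \<forall>v\<in>TC A x. D (\<lambda>y. s y + t y) x v = D s x v + D t x v)" (is ?add)
    and "\<forall>f. smooth_on A U f \<longrightarrow>
      (\<forall>x\<in>U. \<forall>v\<in>TC A x. D (\<lambda>y. vscale E (f y) (s y)) x v =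
         vscale E (v f) (s x) + vscale E (f x) (D s x v))" (is ?leibniz)
    and "\<forall>t. smooth_section A E U t \<longrightarrow> (\<forall>y\<in>U. s y = t y) \<longrightarrow>
      (\<forall>x\<in>U. \<forall>v\<in>TC A x. D s x v = D t x v)" (is ?cong)
proof -
  have "?point \<and> ?smooth \<and> ?add \<and> ?leibniz \<and> ?cong"
    by (rule assms(1)[unfolded connection_def, rule_format (no_asm), OF assms(2,3)])
  note all = this
  from all show ?point by (elim conjE)
  from all show ?smooth by (elim conjE)
  from all show ?add by (elim conjE)
  from all show ?leibniz by (elim conjE)
  from all show ?cong by (elim conjE)
qed

lemma connD:
  assumes D: "connection A E D" "open U" "smooth_section A E U s" and x: "x \<in> U"
  shows conn_fibre: "v \<in> TC A x \<Longrightarrow> D s x v \<in> fibre E x"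
    and conn_add_vec: "u \<in> TC A x \<Longrightarrow> v \<in> TC A x \<Longrightarrow> D s x (\<lambda>f. u f + v f) = D s x u + D s x v"
    and conn_scale_vec: "v \<in> TC A x \<Longrightarrow> D s x (\<lambda>f. c * v f) = vscale E c (D s x v)"
    and conn_add: "v \<in> TC A x \<Longrightarrow> smooth_section A E U t \<Longrightarrow>
      D (\<lambda>y. s y + t y) x v = D s x v + D t x v"
    and conn_leibniz: "v \<in> TC A x \<Longrightarrow> smooth_on A U f \<Longrightarrow>
      D (\<lambda>y. vscale E (f y) (s y)) x v = vscale E (v f) (s x) + vscale E (f x) (D s x v)"
    and conn_cong: "v \<in> TC A x \<Longrightarrow> smooth_section A E U t \<Longrightarrow> (\<And>y. y \<in> U \<Longrightarrow> s y = t y) \<Longrightarrow>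
      D s x v = D t x v"
proof -
  note c = connection_at[OF D]
  show "v \<in> TC A x \<Longrightarrow> D s x v \<in> fibre E x" using c(1) x by blast
  show "u \<in> TC A x \<Longrightarrow> v \<in> TC A x \<Longrightarrow> D s x (\<lambda>f. u f + v f) = D s x u + D s x v"
    using c(1) x by blast
  show "v \<in> TC A x \<Longrightarrow> D s x (\<lambda>f. c * v f) = vscale E c (D s x v)" using c(1) x by blast
  show "v \<in> TC A x \<Longrightarrow> smooth_section A E U t \<Longrightarrow>
      D (\<lambda>y. s y + t y) x v = D s x v + D t x v" using c(3) x by simp
  show "v \<in> TC A x \<Longrightarrow> smooth_on A U f \<Longrightarrow>
      D (\<lambda>y. vscale E (f y) (s y)) x v = vscale E (v f) (s x) + vscale E (f x) (D s x v)"
    using c(4) x by simp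
  show "v \<in> TC A x \<Longrightarrow> smooth_section A E U t \<Longrightarrow> (\<And>y. y \<in> U \<Longrightarrow> s y = t y) \<Longrightarrow>
      D s x v = D t x v" using c(5) x by simp
qed

lemma conn_smooth:
  assumes "connection A E D" "open U" "smooth_section A E U s" "smooth_field A U \<xi>"
  shows "smooth_section A E U (\<lambda>x. D s x (\<xi> x))"
  using connection_at(2)[OF assms(1-3)] assms(4) by simp

lemma chern_conn: "chern_connection A E b D \<Longrightarrow> connection A E D"
  unfolding chern_connection_def by (elim conjE)

lemma chern_compat:
  assumes "chern_connection A E b D" "open U" "smooth_section A E U s" "smooth_section A E U t"
    "x \<in> U" "v \<in> TC A x"
  shows "v (\<lambda>y. b y (s y) (t y)) = b x (D s x v) (t x) + b x (s x) (D t x (conj_vec v))"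
proof -
  have "\<forall>U s t. open U \<longrightarrow> smooth_section A E U s \<longrightarrow> smooth_section A E U t \<longrightarrow>
      (\<forall>x\<in>U. \<forall>v\<in>TC A x.
         v (\<lambda>y. b y (s y) (t y)) = b x (D s x v) (t x) + b x (s x) (D t x (conj_vec v)))"
    using assms(1)[unfolded chern_connection_def] by (elim conjE)
  from this[rule_format (no_asm), OF assms(2-4)] show ?thesis using assms(5,6) by blast
qed

lemma chern_dbar:
  assumes "chern_connection A E b D" "open U" "smooth_section A E U s"
    "x \<in> U" "v \<in> T01 A x" "(V, \<psi>) \<in> trivs E" "x \<in> V"
  shows "D s x v = dbar_in E \<psi> s x v"
proof -
  have "\<forall>U s. open U \<longrightarrow> smooth_section A E U s \<longrightarrow>
      (\<forall>x\<in>U. \<forall>v\<in>T01 A x. \<forall>(V, \<psi>)\<in>trivs E. x \<in> V \<longrightarrow> D s x v = dbar_in E \<psi> s x v)"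
    using assms(1)[unfolded chern_connection_def] by (elim conjE)
  from this[rule_format (no_asm), OF assms(2,3)]
  have "\<forall>(V, \<psi>)\<in>trivs E. x \<in> V \<longrightarrow> D s x v = dbar_in E \<psi> s x v" using assms(4,5) by blast
  from bspec[OF this assms(6)] show ?thesis using assms(7) by simp
qed

text \<open>On vectors of type (0,1) every Chern connection is \<open>\<partial>\<close>bar, whatever the form.\<close>

lemma chern_dbar_unique:
  assumes "chern_connection A E b D" "chern_connection A E b' D'" "open U" "smooth_section A E U s"
    "x \<in> U" "v \<in> T01 A x"
  shows "D s x v = D' s x v"
proof -
  obtain V \<psi> where "(V, \<psi>) \<in> trivs E" "x \<in> V" using triv_at .
  from chern_dbar[OF assms(1,3-6) this] chern_dbar[OF assms(2-6) this] show ?thesis by simp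
qed

lemma chern_compat_left:
  assumes D: "chern_connection A E b D"
    and U: "open U" "x \<in> U" and s: "smooth_section A E U s" and t: "smooth_section A E U t"
    and u: "u \<in> TC A x"
  shows "b x (D s x u) (t x) = u (\<lambda>y. b y (s y) (t y)) - b x (s x) (D t x (conj_vec u))"
  using chern_compat[OF D U(1) s t U(2) u] by simp

text \<open>By additivity in \<open>u\<close> it suffices to treat the two types. For type (0,1) all three connections agree.
For type (1,0) move the derivative to a section \<open>t\<close> through \<open>e\<close>: there it is of type (0,1), hence
common to the three connections, and the remaining term is the derivative of a sum of functions.\<close>

lemma chern_sum:
  assumes h: "smooth_hermitian_form A E h"
    and b1: "smooth_hermitian_form A E b1" and b2: "smooth_hermitian_form A E b2"
    and sum: "\<And>x s t. h x s t = b1 x s t + b2 x s t"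
    and Dh: "chern_connection A E h D" and D1: "chern_connection A E b1 D1"
    and D2: "chern_connection A E b2 D2"
    and U: "open U" "x \<in> U" and s: "smooth_section A E U s"
    and u: "u \<in> TC A x" and e: "e \<in> fibre E x"
  shows "h x (D s x u) e = b1 x (D1 s x u) e + b2 x (D2 s x u) e"
proof -
  obtain V t where V: "open V" "x \<in> V" "smooth_section A E V t" "t x = e"
    using section_through[OF e] .
  define W where "W = U \<inter> V"
  have W: "open W" "x \<in> W" using U V by (auto simp: W_def)
  have sW: "smooth_section A E W s" and tW: "smooth_section A E W t"
    using smooth_section_subset s V(3) by (auto simp: W_def)
  obtain v w where v: "v \<in> T10 A x" and w: "w \<in> T01 A x" and uvw: "u = (\<lambda>f. v f + w f)"
    using u unfolding TC_def by blast
  have vTC: "v \<in> TC A x" and wTC: "w \<in> TC A x" using v w T10_subset_TC T01_subset_TC by auto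
  have w1: "D1 s x w = D s x w" and w2: "D2 s x w = D s x w"
    using chern_dbar_unique[OF D1 Dh W(1) sW W(2) w] chern_dbar_unique[OF D2 Dh W(1) sW W(2) w] by auto
  have t1: "D1 t x (conj_vec v) = D t x (conj_vec v)" and t2: "D2 t x (conj_vec v) = D t x (conj_vec v)"
    using chern_dbar_unique[OF D1 Dh W(1) tW W(2) conj_vec_T10[OF v]]
      chern_dbar_unique[OF D2 Dh W(1) tW W(2) conj_vec_T10[OF v]] by auto
  have near: "smooth_near A x (\<lambda>y. g y (s y) (t y))" if "smooth_hermitian_form A E g" for g
    by (rule smooth_nearI[OF W herm_smooth[OF that W(1) sW tW]])
  have "h x (D s x v) e = b1 x (D1 s x v) e + b2 x (D2 s x v) e"
    using chern_compat_left[OF Dh W sW tW vTC] chern_compat_left[OF D1 W sW tW vTC] chern_compat_left[OF D2 W sW tW vTC]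
      TC_add[OF vTC near[OF b1] near[OF b2]]
    by (simp add: V(4) t1 t2 sum)
  moreover have "h x (D s x w) e = b1 x (D1 s x w) e + b2 x (D2 s x w) e"
    by (simp add: w1 w2 sum)
  moreover have split: "g x (D' s x u) e = g x (D' s x v) e + g x (D' s x w) e"
    if g: "smooth_hermitian_form A E g" and D': "chern_connection A E g D'" for g D'
    unfolding uvw conn_add_vec[OF chern_conn[OF D'] U(1) s U(2) vTC wTC]
    by (rule herm_add_left[OF g _ _ e]) (rule conn_fibre[OF chern_conn[OF D'] U(1) s U(2)], fact)+
  ultimately show ?thesis
    unfolding split[OF h Dh] split[OF b1 D1] split[OF b2 D2] by simp
qed

text \<open>Although a degenerate form may have several Chern connections, they differ by sections of its kernel.
This allows a Chern connection that was chosen arbitrarily to be exchanged for a given one.\<close>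

lemma chern_unique:
  assumes b: "smooth_hermitian_form A E b"
    and D: "chern_connection A E b D" and D': "chern_connection A E b D'"
    and U: "open U" "x \<in> U" and s: "smooth_section A E U s"
    and u: "u \<in> TC A x" and e: "e \<in> fibre E x"
  shows "b x (D s x u) e = b x (D' s x u) e"
proof -
  obtain V t where V: "open V" "x \<in> V" "smooth_section A E V t" "t x = e"
    using section_through[OF e] .
  define W where "W = U \<inter> V"
  have W: "open W" "x \<in> W" using U V by (auto simp: W_def)
  have sW: "smooth_section A E W s" and tW: "smooth_section A E W t"
    using smooth_section_subset s V(3) by (auto simp: W_def)
  obtain v w where v: "v \<in> T10 A x" and w: "w \<in> T01 A x" and uvw: "u = (\<lambda>f. v f + w f)"
    using u unfolding TC_def by blast
  have vTC: "v \<in> TC A x" and wTC: "w \<in> TC A x" using v w T10_subset_TC T01_subset_TC by auto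
  have "b x (D s x v) e = b x (D' s x v) e"
    using chern_compat_left[OF D W sW tW vTC] chern_compat_left[OF D' W sW tW vTC]
      chern_dbar_unique[OF D D' W(1) tW W(2) conj_vec_T10[OF v]] V(4) by simp
  moreover have "D s x w = D' s x w" by (rule chern_dbar_unique[OF D D' U(1) s U(2) w])
  ultimately show ?thesis
    unfolding uvw conn_add_vec[OF chern_conn[OF D] U(1) s U(2) vTC wTC]
      conn_add_vec[OF chern_conn[OF D'] U(1) s U(2) vTC wTC]
    using herm_add_left[OF b conn_fibre[OF chern_conn[OF D] U(1) s U(2) vTC] conn_fibre[OF chern_conn[OF D] U(1) s U(2) wTC] e]
      herm_add_left[OF b conn_fibre[OF chern_conn[OF D'] U(1) s U(2) vTC] conn_fibre[OF chern_conn[OF D'] U(1) s U(2) wTC] e]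
    by simp
qed

section \<open>The Chern connection of a sum\<close>

text \<open>The two summands \<open>h\<^sup>-\<^sup>1 b\<^sub>i\<close> are endomorphisms adding up to the identity. Hence the combination satisfies
the Leibniz rule and agrees with \<open>\<partial>\<close>bar on vectors of type (0,1), while compatibility with \<open>h\<close> is the
sum of the compatibilities with \<open>b\<^sub>1\<close> and \<open>b\<^sub>2\<close>.\<close>

lemma chern_connection_exists:
  assumes h: "smooth_hermitian_form A E h" "positive_definite E h"
    and b1: "smooth_hermitian_form A E b1" and b2: "smooth_hermitian_form A E b2"
    and sum: "\<And>x s t. h x s t = b1 x s t + b2 x s t"
    and D1: "chern_connection A E b1 D1" and D2: "chern_connection A E b2 D2"
  shows "chern_connection A E h
    (\<lambda>s x v. inv_comp E h b1 x (D1 s x v) + inv_comp E h b2 x (D2 s x v))" (is "chern_connection A E h ?D")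
proof -
  define B where "B b x s = inv_comp E h b x s" for b x s
  have B_fibre: "B b x s \<in> fibre E x" if "smooth_hermitian_form A E b" "s \<in> fibre E x" for b x s
    unfolding B_def using inv_comp_fibre[OF h that] .
  have B_eq: "h x (B b x s) t = b x s t"
    if "smooth_hermitian_form A E b" "s \<in> fibre E x" "t \<in> fibre E x" for b x s t
    unfolding B_def using inv_comp_eq[OF h that] .
  have B_add: "B b x (s + s') = B b x s + B b x s'"
    if b: "smooth_hermitian_form A E b" and s: "s \<in> fibre E x" "s' \<in> fibre E x" for b x s s'
    by (rule herm_nondegenerate[OF h, where x = x])
       (simp_all add: B_fibre[OF b] fibre_add s B_eq[OF b] herm_add_left[OF h(1)] herm_add_left[OF b])
  have B_scale: "B b x (vscale E c s) = vscale E c (B b x s)"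
    if b: "smooth_hermitian_form A E b" and s: "s \<in> fibre E x" for b x c s
    by (rule herm_nondegenerate[OF h, where x = x])
       (simp_all add: B_fibre[OF b] fibre_scale s B_eq[OF b] herm_scale_left[OF h(1)] herm_scale_left[OF b])
  have B_sum: "B b1 x s + B b2 x s = s" if s: "s \<in> fibre E x" for x s
    by (rule herm_nondegenerate[OF h, where x = x])
       (simp_all add: B_fibre[OF b1] B_fibre[OF b2] fibre_add s herm_add_left[OF h(1)] B_eq[OF b1] B_eq[OF b2] sum[of x s])
  have vs_add: "vscale E c (u + w) = vscale E c u + vscale E c w" for c u w
    by (rule module.scale_right_distrib[OF module_vscale])
  define D where "D s x v = B b1 x (D1 s x v) + B b2 x (D2 s x v)" for s x v
  note c1 = connD[OF chern_conn[OF D1]] and c2 = connD[OF chern_conn[OF D2]]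
  have conn: "connection A E D"
    unfolding connection_def
  proof (intro allI impI conjI ballI)
    fix U s assume U: "open U" and s: "smooth_section A E U s"
    note c1 = c1[OF U s] and c2 = c2[OF U s]
    note f1 = B_fibre[OF b1 c1(1)] and f2 = B_fibre[OF b2 c2(1)]
    {
      fix x u v c assume x: "x \<in> U" and u: "u \<in> TC A x" and v: "v \<in> TC A x"
      show "D s x v \<in> fibre E x" unfolding D_def by (intro fibre_add f1 f2 x v)
      show "D s x (\<lambda>f. u f + v f) = D s x u + D s x v"
        by (simp add: D_def c1(2)[OF x u v] c2(2)[OF x u v] B_add[OF b1 c1(1)[OF x u] c1(1)[OF x v]]
            B_add[OF b2 c2(1)[OF x u] c2(1)[OF x v]])
      show "D s x (\<lambda>f. c * v f) = vscale E c (D s x v)"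
        by (simp add: D_def c1(3)[OF x v] c2(3)[OF x v] B_scale[OF b1 c1(1)[OF x v]]
            B_scale[OF b2 c2(1)[OF x v]] vs_add)
    }
    show "smooth_section A E U (\<lambda>x. D s x (\<xi> x))" if "smooth_field A U \<xi>" for \<xi>
      unfolding D_def B_def
      by (intro smooth_section_add[OF U] smooth_section_inv_comp[OF h _ U] b1 b2
          conn_smooth[OF chern_conn[OF D1] U s that] conn_smooth[OF chern_conn[OF D2] U s that])
    {
      fix t x v assume t: "smooth_section A E U t" and x: "x \<in> U" and v: "v \<in> TC A x"
      show "D (\<lambda>y. s y + t y) x v = D s x v + D t x v"
        using conn_fibre[OF chern_conn[OF D1] U t x v] conn_fibre[OF chern_conn[OF D2] U t x v]
        by (simp add: D_def c1(4)[OF x v t] c2(4)[OF x v t] B_add[OF b1 c1(1)[OF x v]]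
            B_add[OF b2 c2(1)[OF x v]])
      show "D s x v = D t x v" if "\<forall>y\<in>U. s y = t y"
        using c1(6)[OF x v t] c2(6)[OF x v t] that by (simp add: D_def)
    }
    fix f :: "'x \<Rightarrow> complex" and x v assume f: "smooth_on A U f" and x: "x \<in> U" and v: "v \<in> TC A x"
    have sx: "s x \<in> fibre E x" by (rule smooth_section_fibre[OF s x])
    have "D (\<lambda>y. vscale E (f y) (s y)) x v =
        vscale E (v f) (B b1 x (s x) + B b2 x (s x)) +
        vscale E (f x) (B b1 x (D1 s x v) + B b2 x (D2 s x v))"
      unfolding D_def c1(5)[OF x v f] c2(5)[OF x v f]
      by (simp add: B_add[OF b1] B_add[OF b2] B_scale[OF b1] B_scale[OF b2] fibre_scale sx
          c1(1)[OF x v] c2(1)[OF x v] vs_add)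
    then show "D (\<lambda>y. vscale E (f y) (s y)) x v = vscale E (v f) (s x) + vscale E (f x) (D s x v)"
      by (simp add: B_sum[OF sx] D_def)
  qed
  have "chern_connection A E h D"
    unfolding chern_connection_def
  proof (intro conjI conn allI impI ballI)
    fix U s t x v
    assume U: "open U" and s: "smooth_section A E U s" and t: "smooth_section A E U t"
      and x: "x \<in> U" and v: "v \<in> TC A x"
    have near: "smooth_near A x (\<lambda>y. g y (s y) (t y))" if "smooth_hermitian_form A E g" for g
      by (rule smooth_nearI[OF U x herm_smooth[OF that U s t]])
    have left: "h x (D s x v) e = b1 x (D1 s x v) e + b2 x (D2 s x v) e"
      if e: "e \<in> fibre E x" and s: "smooth_section A E U s" and v: "v \<in> TC A x" for e s v
      using c1(1)[OF U s x v] c2(1)[OF U s x v]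
      by (simp add: D_def herm_add_left[OF h(1)] B_fibre[OF b1] B_fibre[OF b2] B_eq[OF b1] B_eq[OF b2] e)
    note v' = conj_vec_TC[OF v]
    have sx: "s x \<in> fibre E x" and tx: "t x \<in> fibre E x" using smooth_section_fibre s t x by auto
    have "h x (s x) (D t x (conj_vec v)) = b1 x (s x) (D1 t x (conj_vec v)) + b2 x (s x) (D2 t x (conj_vec v))"
      using left[OF sx t v'] herm_sym[OF h(1) conn_fibre[OF conn U t x v'] sx]
        herm_sym[OF b1 c1(1)[OF U t x v'] sx] herm_sym[OF b2 c2(1)[OF U t x v'] sx] by simp
    moreover have "v (\<lambda>y. h y (s y) (t y)) = v (\<lambda>y. b1 y (s y) (t y)) + v (\<lambda>y. b2 y (s y) (t y))"
      unfolding sum by (rule TC_add[OF v near[OF b1] near[OF b2]])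
    ultimately show "v (\<lambda>y. h y (s y) (t y)) = h x (D s x v) (t x) + h x (s x) (D t x (conj_vec v))"
      using chern_compat[OF D1 U s t x v] chern_compat[OF D2 U s t x v] left[OF tx s v] by simp
  next
    fix U s x v p assume U: "open U" and s: "smooth_section A E U s"
      and x: "x \<in> U" and v: "v \<in> T01 A x" and p: "p \<in> trivs E"
    have vTC: "v \<in> TC A x" using v T01_subset_TC by auto
    have "D s x v = D1 s x v"
      unfolding D_def chern_dbar_unique[OF D2 D1 U s x v] by (rule B_sum[OF c1(1)[OF U s x vTC]])
    then show "case p of (V, \<psi>) \<Rightarrow> x \<in> V \<longrightarrow> D s x v = dbar_in E \<psi> s x v"
      using chern_dbar[OF D1 U s x v] p by auto
  qed
  then show ?thesis unfolding D_def[abs_def] B_def[abs_def] .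
qed

section \<open>Curvature of a sum\<close>

text \<open>What remains of the curvature tensor after removing \<open>b(D\<^sub>\<alpha> s, D\<^sub>\<beta> t)\<close> is additive in the form.\<close>

lemma curvature_sum:
  assumes h: "smooth_hermitian_form A E h"
    and b1: "smooth_hermitian_form A E b1" and b2: "smooth_hermitian_form A E b2"
    and sum: "\<And>x s t. h x s t = b1 x s t + b2 x s t"
    and Dh: "chern_connection A E h D" and D1: "chern_connection A E b1 D1"
    and D2: "chern_connection A E b2 D2"
    and U: "open U" "x \<in> U" and \<alpha>: "smooth_field10 A U \<alpha>" and \<beta>: "smooth_field10 A U \<beta>"
    and s: "smooth_section A E U s" and t: "smooth_section A E U t"
  shows "curvature_tensor_of A h D \<alpha> \<beta> s t x - h x (D s x (\<alpha> x)) (D t x (\<beta> x)) =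
    (curvature_tensor_of A b1 D1 \<alpha> \<beta> s t x - b1 x (D1 s x (\<alpha> x)) (D1 t x (\<beta> x))) +
    (curvature_tensor_of A b2 D2 \<alpha> \<beta> s t x - b2 x (D2 s x (\<alpha> x)) (D2 t x (\<beta> x)))"
proof -
  define \<eta> where "\<eta> y = conj_vec (\<beta> y)" for y
  have \<eta>: "smooth_field A U \<eta>" "\<And>y. y \<in> U \<Longrightarrow> \<eta> y \<in> T01 A y"
    unfolding \<eta>_def using smooth_field10_conj[OF \<beta>] by auto
  have \<alpha>sm: "smooth_field A U \<alpha>" using \<alpha> unfolding smooth_field10_def by blast
  have TC: "\<alpha> y \<in> TC A y" "\<eta> y \<in> TC A y" if "y \<in> U" for y
    using \<alpha>sm \<eta>(1) that unfolding smooth_field_def by auto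
  have br: "lie_bracket A \<alpha> \<eta> x \<in> TC A x" by (rule lie_bracket_TC[OF U \<alpha> \<eta>])
  have tx: "t x \<in> fibre E x" by (rule smooth_section_fibre[OF t U(2)])
  \<comment> \<open>The derivative along \<open>\<eta>\<close> is moved to the other argument, where it becomes one along \<open>\<beta>\<close>.\<close>
  have K: "curvature_tensor_of A b D \<alpha> \<beta> s t x - b x (D s x (\<alpha> x)) (D t x (\<beta> x)) =
      b x (D (\<lambda>y. D s y (\<eta> y)) x (\<alpha> x)) (t x) - \<eta> x (\<lambda>y. b y (D s y (\<alpha> y)) (t y))
      - b x (D s x (lie_bracket A \<alpha> \<eta> x)) (t x)"
    if b: "smooth_hermitian_form A E b" and D: "chern_connection A E b D" for b D
  proof -
    note conn = chern_conn[OF D]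
    have s\<alpha>: "smooth_section A E U (\<lambda>y. D s y (\<alpha> y))" and s\<eta>: "smooth_section A E U (\<lambda>y. D s y (\<eta> y))"
      using conn_smooth[OF conn U(1) s] \<alpha>sm \<eta>(1) by auto
    have f1: "D (\<lambda>y. D s y (\<eta> y)) x (\<alpha> x) \<in> fibre E x"
      by (rule conn_fibre[OF conn U(1) s\<eta> U(2) TC(1)[OF U(2)]])
    have f2: "D (\<lambda>y. D s y (\<alpha> y)) x (\<eta> x) \<in> fibre E x"
      by (rule conn_fibre[OF conn U(1) s\<alpha> U(2) TC(2)[OF U(2)]])
    have f3: "D s x (lie_bracket A \<alpha> \<eta> x) \<in> fibre E x"
      by (rule conn_fibre[OF conn U(1) s U(2) br])
    have "curvature_tensor_of A b D \<alpha> \<beta> s t x =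
        b x (D (\<lambda>y. D s y (\<eta> y)) x (\<alpha> x)) (t x) - b x (D (\<lambda>y. D s y (\<alpha> y)) x (\<eta> x)) (t x)
        - b x (D s x (lie_bracket A \<alpha> \<eta> x)) (t x)"
      unfolding curvature_tensor_of_def ext_cov_deriv_def \<eta>_def[symmetric]
      using herm_diff_left[OF b fibre_diff[OF f1 f2] f3 tx] herm_diff_left[OF b f1 f2 tx] by simp
    moreover have "b x (D (\<lambda>y. D s y (\<alpha> y)) x (\<eta> x)) (t x) =
        \<eta> x (\<lambda>y. b y (D s y (\<alpha> y)) (t y)) - b x (D s x (\<alpha> x)) (D t x (\<beta> x))"
      using chern_compat_left[OF D U s\<alpha> t TC(2)[OF U(2)]] by (simp add: \<eta>_def)
    ultimately show ?thesis by simp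
  qed
  note eq = chern_sum[OF h b1 b2 sum Dh D1 D2 U(1)]
  have s\<eta>: "smooth_section A E U (\<lambda>y. D s y (\<eta> y))"
    by (rule conn_smooth[OF chern_conn[OF Dh] U(1) s \<eta>(1)])
  \<comment> \<open>The inner derivative is of type (0,1), so it is the same section for all connections.\<close>
  have dbar: "D' (\<lambda>y. D' s y (\<eta> y)) x (\<alpha> x) = D' (\<lambda>y. D s y (\<eta> y)) x (\<alpha> x)"
    if D': "chern_connection A E b D'" for b D'
    by (rule conn_cong[OF chern_conn[OF D'] U(1) conn_smooth[OF chern_conn[OF D'] U(1) s \<eta>(1)] U(2)
          TC(1)[OF U(2)] s\<eta>])
       (rule chern_dbar_unique[OF D' Dh U(1) s _ \<eta>(2)])
  have first: "h x (D (\<lambda>y. D s y (\<eta> y)) x (\<alpha> x)) (t x) =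
      b1 x (D1 (\<lambda>y. D1 s y (\<eta> y)) x (\<alpha> x)) (t x) + b2 x (D2 (\<lambda>y. D2 s y (\<eta> y)) x (\<alpha> x)) (t x)"
    unfolding dbar[OF D1] dbar[OF D2] by (rule eq[OF U(2) s\<eta> TC(1)[OF U(2)] tx])
  have near: "smooth_near A x (\<lambda>y. b y (D' s y (\<alpha> y)) (t y))"
    if b: "smooth_hermitian_form A E b" and D': "chern_connection A E b D'" for b D'
    by (rule smooth_nearI[OF U herm_smooth[OF b U(1) conn_smooth[OF chern_conn[OF D'] U(1) s \<alpha>sm] t]])
  have "\<eta> x (\<lambda>y. h y (D s y (\<alpha> y)) (t y)) =
      \<eta> x (\<lambda>y. b1 y (D1 s y (\<alpha> y)) (t y) + b2 y (D2 s y (\<alpha> y)) (t y))"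
    by (rule TC_cong[OF TC(2)[OF U(2)] U]) (rule eq[OF _ s TC(1) smooth_section_fibre[OF t]])
  also have "\<dots> = \<eta> x (\<lambda>y. b1 y (D1 s y (\<alpha> y)) (t y)) + \<eta> x (\<lambda>y. b2 y (D2 s y (\<alpha> y)) (t y))"
    by (rule TC_add[OF TC(2)[OF U(2)] near[OF b1 D1] near[OF b2 D2]])
  finally have second: "\<eta> x (\<lambda>y. h y (D s y (\<alpha> y)) (t y)) = \<dots>" .
  have third: "h x (D s x (lie_bracket A \<alpha> \<eta> x)) (t x) =
      b1 x (D1 s x (lie_bracket A \<alpha> \<eta> x)) (t x) + b2 x (D2 s x (lie_bracket A \<alpha> \<eta> x)) (t x)"
    by (rule eq[OF U(2) s br tx])
  show ?thesis unfolding K[OF h Dh] K[OF b1 D1] K[OF b2 D2] first second third by simp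
qed

text \<open>The equations for \<open>p\<close> say \<open>p\<^sub>1 - p = h\<^sup>-\<^sup>1 b\<^sub>2 (p\<^sub>1 - p\<^sub>2)\<close> and \<open>p - p\<^sub>2 = h\<^sup>-\<^sup>1 b\<^sub>1 (p\<^sub>1 - p\<^sub>2)\<close>, and likewise for
\<open>r\<close>. So \<open>q\<close> is \<open>b\<^sub>1(p\<^sub>1 - p, r\<^sub>1 - r) + b\<^sub>2(p\<^sub>2 - p, r\<^sub>2 - r)\<close>, the excess of a quadratic expression over
its value at the mean, as in the variance formula.\<close>

lemma hermitian_sum_defect:
  assumes h: "smooth_hermitian_form A E h" "positive_definite E h"
    and b1: "smooth_hermitian_form A E b1" and b2: "smooth_hermitian_form A E b2"
    and sum: "\<And>x s t. h x s t = b1 x s t + b2 x s t"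
    and p: "p \<in> fibre E x" "p1 \<in> fibre E x" "p2 \<in> fibre E x"
    and r: "r \<in> fibre E x" "r1 \<in> fibre E x" "r2 \<in> fibre E x"
    and hp: "\<And>e. e \<in> fibre E x \<Longrightarrow> h x p e = b1 x p1 e + b2 x p2 e"
    and hr: "\<And>e. e \<in> fibre E x \<Longrightarrow> h x r e = b1 x r1 e + b2 x r2 e"
  shows "h x p r = b1 x p1 r1 + b2 x p2 r2 - q_form E h b1 b2 x (p1 - p2) (r1 - r2)"
proof -
  define B1 B2 where "B1 = inv_comp E h b1 x" and "B2 = inv_comp E h b2 x"
  have B1: "B1 s \<in> fibre E x" "t \<in> fibre E x \<Longrightarrow> h x (B1 s) t = b1 x s t" if "s \<in> fibre E x" for s t
    unfolding B1_def using inv_comp_fibre[OF h b1 that] inv_comp_eq[OF h b1 that] by auto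
  have B2: "B2 s \<in> fibre E x" "t \<in> fibre E x \<Longrightarrow> h x (B2 s) t = b2 x s t" if "s \<in> fibre E x" for s t
    unfolding B2_def using inv_comp_fibre[OF h b2 that] inv_comp_eq[OF h b2 that] by auto
  have parts: "p1 - p = B2 (p1 - p2)" "p - p2 = B1 (p1 - p2)"
    if p: "p \<in> fibre E x" "p1 \<in> fibre E x" "p2 \<in> fibre E x"
      and hp: "\<And>e. e \<in> fibre E x \<Longrightarrow> h x p e = b1 x p1 e + b2 x p2 e" for p p1 p2
  proof -
    note d = fibre_diff[OF p(2,3)]
    show "p1 - p = B2 (p1 - p2)"
      by (rule herm_nondegenerate[OF h, where x = x])
         (simp_all add: fibre_diff p B2[OF d] herm_diff_left[OF h(1)] herm_diff_left[OF b2] hp sum[of x p1])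
    show "p - p2 = B1 (p1 - p2)"
      by (rule herm_nondegenerate[OF h, where x = x])
         (simp_all add: fibre_diff p B1[OF d] herm_diff_left[OF h(1)] herm_diff_left[OF b1] hp sum[of x p2])
  qed
  note dl1 = herm_diff_left[OF b1] and dl2 = herm_diff_left[OF b2]
  note dr1 = herm_diff_right[OF b1] and dr2 = herm_diff_right[OF b2]
  have hr': "b1 x e r + b2 x e r = b1 x e r1 + b2 x e r2" if e: "e \<in> fibre E x" for e
    using hr[OF e] herm_sym[OF h(1) r(1) e] herm_sym[OF b1 r(2) e] herm_sym[OF b2 r(3) e] sum[of x e r]
    by simp
  have "q_form E h b1 b2 x (p1 - p2) (r1 - r2) = b1 x (p1 - p) (r1 - r) + b2 x (p - p2) (r - r2)"
    by (simp add: q_form_def B1_def[symmetric] B2_def[symmetric] parts[OF p hp] parts[OF r hr])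
  also have "\<dots> = b1 x p1 r1 + b2 x p2 r2 - h x p r
      - (b1 x p1 r + b2 x p2 r - h x p r) - (b1 x p r1 + b2 x p r2 - h x p r)"
    by (simp add: dl1 dl2 dr1 dr2 p r fibre_diff sum algebra_simps)
  also have "\<dots> = b1 x p1 r1 + b2 x p2 r2 - h x p r"
    using hp[OF r(1)] hr'[OF p(1)] by (simp add: sum)
  finally show ?thesis by simp
qed

end

section \<open>The curvature formula\<close>

theorem corollary2p16:
  fixes A :: "('x::{t2_space, second_countable_topology}, 'n::finite) chart set"
    and E :: "('x, 'v::ab_group_add, 'r::finite) vbundle"
    and b1 b2 h :: "'x \<Rightarrow> 'v \<Rightarrow> 'v \<Rightarrow> complex"
    and D1 D2 :: "('x, 'v) connect"
  assumes "complex_manifold A"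
    and "holomorphic_vector_bundle A E"
    and "smooth_hermitian_form A E b1"
    and "smooth_hermitian_form A E b2"
    and "chern_connection A E b1 D1"
    and "chern_connection A E b2 D2"
    and "h = (\<lambda>x s t. b1 x s t + b2 x s t)"
    and "positive_definite E h"
  shows "\<forall>U \<alpha> \<beta> s t. open U \<longrightarrow> smooth_field10 A U \<alpha> \<longrightarrow> smooth_field10 A U \<beta> \<longrightarrow>
           smooth_section A E U s \<longrightarrow> smooth_section A E U t \<longrightarrow>
           (\<forall>x\<in>U. curvature_tensor A E h \<alpha> \<beta> s t x =
              curvature_tensor A E b1 \<alpha> \<beta> s t x + curvature_tensor A E b2 \<alpha> \<beta> s t x
              - q_form E h b1 b2 x (conn_diff D1 D2 \<alpha> s x) (conn_diff D1 D2 \<beta> t x))"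
proof (intro allI impI ballI)
  fix U \<alpha> \<beta> s t x
  assume U: "open U" and \<alpha>: "smooth_field10 A U \<alpha>" and \<beta>: "smooth_field10 A U \<beta>"
    and s: "smooth_section A E U s" and t: "smooth_section A E U t" and x: "x \<in> U"
  interpret hol_bundle A E by unfold_locales (rule assms)+
  note b1 = assms(3) and b2 = assms(4) and D1 = assms(5) and D2 = assms(6) and pos = assms(8)
  have h: "smooth_hermitian_form A E h"
    unfolding assms(7) by (rule smooth_hermitian_form_add[OF b1 b2])
  have sum: "h x s t = b1 x s t + b2 x s t" for x s t by (simp add: assms(7))
  define Dh where "Dh = (SOME D. chern_connection A E h D)"
  define C1 where "C1 = (SOME D. chern_connection A E b1 D)"
  define C2 where "C2 = (SOME D. chern_connection A E b2 D)"
  have Dh: "chern_connection A E h Dh"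
    unfolding Dh_def by (rule someI[where P = "chern_connection A E h", OF chern_connection_exists[OF h pos b1 b2 sum D1 D2]])
  have C1: "chern_connection A E b1 C1" unfolding C1_def by (rule someI[where P = "chern_connection A E b1", OF D1])
  have C2: "chern_connection A E b2 C2" unfolding C2_def by (rule someI[where P = "chern_connection A E b2", OF D2])
  have \<alpha>x: "\<alpha> x \<in> TC A x" and \<beta>x: "\<beta> x \<in> TC A x"
    using \<alpha> \<beta> x unfolding smooth_field10_def smooth_field_def by auto
  have fib: "D s x (\<alpha> x) \<in> fibre E x" "D t x (\<beta> x) \<in> fibre E x"
    if "chern_connection A E b D" for b D
    using conn_fibre[OF chern_conn[OF that] U s x \<alpha>x] conn_fibre[OF chern_conn[OF that] U t x \<beta>x]
    by auto
  \<comment> \<open>The products of derivatives depend on the form only, not on the chosen Chern connection.\<close>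
  have swap: "b x (C s x (\<alpha> x)) (C t x (\<beta> x)) = b x (D s x (\<alpha> x)) (D t x (\<beta> x))"
    if b: "smooth_hermitian_form A E b" and C: "chern_connection A E b C"
      and D: "chern_connection A E b D" for b C D
  proof -
    have "b x (C s x (\<alpha> x)) (C t x (\<beta> x)) = b x (D s x (\<alpha> x)) (C t x (\<beta> x))"
      by (rule chern_unique[OF b C D U x s \<alpha>x fib(2)[OF C]])
    also have "\<dots> = cnj (b x (C t x (\<beta> x)) (D s x (\<alpha> x)))"
      by (rule herm_sym[OF b fib(2)[OF C] fib(1)[OF D]])
    also have "b x (C t x (\<beta> x)) (D s x (\<alpha> x)) = b x (D t x (\<beta> x)) (D s x (\<alpha> x))"
      by (rule chern_unique[OF b C D U x t \<beta>x fib(1)[OF D]])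
    also have "cnj \<dots> = b x (D s x (\<alpha> x)) (D t x (\<beta> x))"
      by (rule herm_sym[OF b fib(2)[OF D] fib(1)[OF D], symmetric])
    finally show ?thesis .
  qed
  have "h x (Dh s x (\<alpha> x)) (Dh t x (\<beta> x)) =
      b1 x (D1 s x (\<alpha> x)) (D1 t x (\<beta> x)) + b2 x (D2 s x (\<alpha> x)) (D2 t x (\<beta> x))
      - q_form E h b1 b2 x (D1 s x (\<alpha> x) - D2 s x (\<alpha> x)) (D1 t x (\<beta> x) - D2 t x (\<beta> x))"
    by (rule hermitian_sum_defect[OF h pos b1 b2 sum fib(1)[OF Dh] fib(1)[OF D1] fib(1)[OF D2]
          fib(2)[OF Dh] fib(2)[OF D1] fib(2)[OF D2]
          chern_sum[OF h b1 b2 sum Dh D1 D2 U x s \<alpha>x] chern_sum[OF h b1 b2 sum Dh D1 D2 U x t \<beta>x]])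
  then show "curvature_tensor A E h \<alpha> \<beta> s t x =
      curvature_tensor A E b1 \<alpha> \<beta> s t x + curvature_tensor A E b2 \<alpha> \<beta> s t x
      - q_form E h b1 b2 x (conn_diff D1 D2 \<alpha> s x) (conn_diff D1 D2 \<beta> t x)"
    using curvature_sum[OF h b1 b2 sum Dh C1 C2 U x \<alpha> \<beta> s t] swap[OF b1 C1 D1] swap[OF b2 C2 D2]
    unfolding curvature_tensor_def Dh_def[symmetric] C1_def[symmetric] C2_def[symmetric]
      conn_diff_def by algebra
qed

end
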